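(* Let $\Lambda\in(\mathbb R_+^\ast)^N$, let $\mathfrak B$ be a nonempty bounded subset of $\mathcal M_d(\mathbb C)^N$, and let $\mathcal A=L^\infty(\mathbb R,\mathfrak B)$. The following statements are equivalent: (i) $\mu(\Lambda,\mathfrak B)<1$; (ii) $\Sigma_\delta(\Lambda,\mathcal A)$ is exponentially stable in $\mathsf X_p^\delta$ for some $p\in[1,+\infty]$; (iii) $\Sigma_\delta(L,\mathcal A)$ is exponentially stable in $\mathsf X_p^\delta$ for every $L\in V_+(\Lambda)$ and every $p\in[1,+\infty]$. Moreover, for every $p\in[1,+\infty]$, $$\lambda_p(\Lambda,\mathcal A)=\inf\{\nu\in\mathbb R:\mu(\Lambda,\mathfrak B_{-\nu})<1\},$$ where $\mathfrak B_{-\nu}=\{(e^{-\nu\Lambda_1}B_1,\dots,e^{-\nu\Lambda_N}B_N):(B_1,\dots,B_N)\in\mathfrak B\}$.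
   Context: $\mathbb N=\{0,1,2,\dots\}$, $\mathbb R_+^\ast=(0,+\infty)$; $\mathcal M_d(\mathbb C)$ is the set of complex $d\times d$ matrices with a fixed norm $|\cdot|$; $e_1,\dots,e_N$ is the canonical basis of $\mathbb Z^N$; $|\mathbf n|_1$ is the sum of the components of $\mathbf n\in\mathbb N^N$; $L_{\max}$ is the largest component of $L$. Convention $\ln0=-\infty$. Products $\prod_{k=1}^nX_k=X_1\cdots X_n$ are ordered. $L^\infty(\mathbb R,\mathfrak B)$ is the set of measurable functions from $\mathbb R$ to $\mathfrak B$. $Z(\Lambda)=\{\mathbf n\in\mathbb Z^N:\Lambda\cdot\mathbf n=0\}$; $V_+(\Lambda)=\{L\in(\mathbb R_+^\ast)^N:Z(\Lambda)\subset Z(L)\}$. For $L\in(\mathbb R_+^\ast)^N$ and $A=(A_1,\dots,A_N)$, $\Sigma_\delta(L,A)$ is the difference equation $u(t)=\sum_{j=1}^NA_j(t)u(t-L_j)$, $t\ge0$, $u(t)\in\mathbb C^d$, with initial condition $u=u_0$ on $[-L_{\max},0)$; $\mathsf X_p^\delta=L^p([-L_{\max},0],\mathbb C^d)$ with its usual norm $\|\cdot\|_p$; $u_t=u(\cdot+t)|_{[-L_{\max},0)}$. The family $\Sigma_\delta(L,\mathcal A)=\{\Sigma_\delta(L,A)\}_{A\in\mathcal A}$ is of exponential type $\gamma\in\mathbb R$ in $\mathsf X_p^\delta$ if for every $\varepsilon>0$ there is $K>0$ such that $\|u_t\|_p\le Ke^{(\gamma+\varepsilon)t}\|u_0\|_p$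 for all $A\in\mathcal A$, $u_0\in\mathsf X_p^\delta$, $t\ge0$; it is exponentially stable in $\mathsf X_p^\delta$ if it is of exponential type $\gamma$ for some $\gamma<0$. $\lambda_p(L,\mathcal A)=\limsup_{t\to+\infty}\sup_{A\in\mathcal A}\sup_{\|u_0\|_p=1}\frac{\ln\|u_t\|_p}{t}$. For $v=(v_1,\dots,v_n)\in\{1,\dots,N\}^n$, $\mathbf p_v(k)=\sum_{j=1}^{k-1}e_{v_j}$ for $k=1,\dots,n+1$. For $\mathbf n\in\mathbb N^N\setminus\{0\}$, $V_{\mathbf n}=\{v\in\{1,\dots,N\}^{|\mathbf n|_1}:\mathbf p_v(|\mathbf n|_1+1)=\mathbf n\}$. $\mathcal L(\Lambda)=\{\Lambda\cdot\mathbf n:\mathbf n\in\mathbb N^N\}$, $\mathcal L_x(\Lambda)=\mathcal L(\Lambda)\cap[0,x)$. Then $$\mu(\Lambda,\mathfrak B)=\limsup_{x\to+\infty,\ x\in\mathcal L(\Lambda)}\ \sup_{\substack{B^r\in\mathfrak B\\ \text{for }r\in\mathcal L_x(\Lambda)}}\Bigg|\sum_{\substack{\mathbf n\in\mathbb N^N\\ \Lambda\cdot\mathbf n=x}}\sum_{v\in V_{\mathbf n}}\prod_{k=1}^{|\mathbf n|_1}B_{v_k}^{\Lambda\cdot\mathbf p_v(k)}\Bigg|^{1/x},$$ where the supremum is over all families $(B^r)_{r\in\mathcal L_x(\Lambda)}$ of elements $B^r=(B^r_1,\dots,B^r_N)\in\mathfrak B$. *)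

theory Defs
  imports "HOL-Analysis.Analysis" "HOL-Probability.Essential_Supremum"
begin

text \<open>
  \<open>'N\<close> and \<open>'d\<close> are finite index types, so that \<open>N = CARD('N) \<ge> 1\<close> and \<open>d = CARD('d) \<ge> 1\<close>.
  Matrices are of type \<open>complex^'d^'d\<close>, and a tuple of \<open>N\<close> matrices is a vector indexed by \<open>'N\<close>.
\<close>

definition is_matrix_norm :: "(complex^'d^'d \<Rightarrow> real) \<Rightarrow> bool" where
  "is_matrix_norm nrm \<longleftrightarrow>
     (\<forall>M. 0 \<le> nrm M) \<and>
     (\<forall>M. nrm M = 0 \<longleftrightarrow> M = 0) \<and>
     (\<forall>c M. nrm (\<chi> i j. c * M $ i $ j) = cmod c * nrm M) \<and>
     (\<forall>M M'. nrm (M + M') \<le> nrm M + nrm M')"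


section \<open>Delays\<close>

definition pos_delays :: "(real^'N) set" where
  "pos_delays = {L. \<forall>j. 0 < L $ j}"

definition L_max :: "real^'N \<Rightarrow> real" where
  "L_max L = Max (range (\<lambda>j. L $ j))"

definition dot_nat :: "real^'N \<Rightarrow> nat^'N \<Rightarrow> real" where
  "dot_nat L n = L \<bullet> (\<chi> i. real (n $ i))"

definition dot_int :: "real^'N \<Rightarrow> int^'N \<Rightarrow> real" where
  "dot_int L n = L \<bullet> (\<chi> i. real_of_int (n $ i))"

definition Z_set :: "real^'N \<Rightarrow> (int^'N) set" where
  "Z_set L = {n. dot_int L n = 0}"

definition V_plus :: "real^'N \<Rightarrow> (real^'N) set" where
  "V_plus \<Lambda> = {L \<in> pos_delays. Z_set \<Lambda> \<subseteq> Z_set L}"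


section \<open>The difference equation\<close>

text \<open>Values of \<open>u\<close> and \<open>u0\<close> outside \<open>[-L_max, \<infinity>)\<close>, respectively \<open>[-L_max, 0)\<close>, are irrelevant.\<close>

definition is_solution ::
  "real^'N \<Rightarrow> (real \<Rightarrow> (complex^'d^'d)^'N) \<Rightarrow> (real \<Rightarrow> complex^'d) \<Rightarrow> (real \<Rightarrow> complex^'d) \<Rightarrow> bool" where
  "is_solution L A u0 u \<longleftrightarrow>
     (\<forall>t. - L_max L \<le> t \<and> t < 0 \<longrightarrow> u t = u0 t) \<and>
     (\<forall>t\<ge>0. u t = (\<Sum>j\<in>UNIV. A t $ j *v u (t - L $ j)))"

lemma step_measure_decreases:
  assumes "0 < m" "m \<le> l" "0 \<le> (t::real)"
  shows "nat (\<lfloor>(t - l) / m\<rfloor> + 1) < nat (\<lfloor>t / m\<rfloor> + 1)"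
proof -
  have "(t - l) / m \<le> t / m - 1"
    using assms by (simp add: field_simps)
  then have "\<lfloor>(t - l) / m\<rfloor> \<le> \<lfloor>t / m - 1\<rfloor>"
    by (rule floor_mono)
  then have "\<lfloor>(t - l) / m\<rfloor> \<le> \<lfloor>t / m\<rfloor> - 1"
    by simp
  moreover have "0 \<le> \<lfloor>t / m\<rfloor>"
    using assms by simp
  ultimately show ?thesis by linarith
qed

lemma pos_delays_lower_bound:
  assumes "L \<in> pos_delays"
  obtains m where "0 < m" "\<And>j. m \<le> L $ j"
proof
  show "0 < Min (range (\<lambda>j. L $ j))"
    using assms by (auto simp: pos_delays_def)
  show "Min (range (\<lambda>j. L $ j)) \<le> L $ j" for j
    by (rule Min_le) auto
qed

lemma is_solution_exists:
  assumes L: "L \<in> pos_delays"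
  shows "\<exists>u. is_solution L A u0 u"
proof -
  obtain m where m: "0 < m" "\<And>j. m \<le> L $ j"
    using pos_delays_lower_bound[OF L] by blast
  define R where "R = inv_image less_than (\<lambda>t. nat (\<lfloor>t / m\<rfloor> + 1))"
  define F where "F = (\<lambda>f t. if t < 0 then u0 t else \<Sum>j\<in>UNIV. A t $ j *v f (t - L $ j))"
  define u where "u = wfrec R F"
  have dec: "(t - L $ j, t) \<in> R" if "0 \<le> t" for t j
    using step_measure_decreases[OF m(1) m(2) that] by (simp add: R_def)
  have step: "u t = F (cut u R t) t" for t
    unfolding u_def by (rule wfrec) (simp add: R_def wf_inv_image)
  have neg: "u t = u0 t" if "t < 0" for t
    using step[of t] that by (simp add: F_def)
  have pos: "u t = (\<Sum>j\<in>UNIV. A t $ j *v u (t - L $ j))" if "0 \<le> t" for t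
    using step[of t] that dec[OF that] by (simp add: F_def cut_apply)
  show ?thesis
    unfolding is_solution_def using neg pos by blast
qed

lemma is_solution_unique:
  assumes L: "L \<in> pos_delays"
    and u: "is_solution L A u0 u" and w: "is_solution L A u0 w"
    and t: "- L_max L \<le> t"
  shows "u t = w t"
proof -
  obtain m where m: "0 < m" "\<And>j. m \<le> L $ j"
    using pos_delays_lower_bound[OF L] by blast
  have max: "L $ j \<le> L_max L" for j
    unfolding L_max_def by (rule Max_ge) auto
  show ?thesis using t
  proof (induction "nat (\<lfloor>t / m\<rfloor> + 1)" arbitrary: t rule: less_induct)
    case less
    show ?case
    proof (cases "t < 0")
      case True
      then show ?thesis using less.prems u w by (simp add: is_solution_def)
    next
      case False
      then have t0: "0 \<le> t" by simp
      have "u (t - L $ j) = w (t - L $ j)" for j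
        using less.hyps[OF step_measure_decreases[OF m(1) m(2) t0]] max[of j] t0 by simp
      then show ?thesis using u w t0 by (simp add: is_solution_def)
    qed
  qed
qed


section \<open>The spaces \<open>L\<^sup>p([-L_max, 0], \<complex>\<^sup>d)\<close> for \<open>p \<in> [1, \<infinity>]\<close>\<close>

definition Lp_norm :: "ennreal \<Rightarrow> real measure \<Rightarrow> (real \<Rightarrow> 'a::real_normed_vector) \<Rightarrow> ennreal" where
  "Lp_norm p M f =
     (if p = \<infinity> then esssup M (\<lambda>s. ennreal (norm (f s)))
      else let I = \<integral>\<^sup>+ s. ennreal (norm (f s) powr enn2real p) \<partial>M
           in if I = \<infinity> then \<infinity> else ennreal (enn2real I powr (1 / enn2real p)))"

definition state_norm :: "real^'N \<Rightarrow> ennreal \<Rightarrow> (real \<Rightarrow> complex^'d) \<Rightarrow> ennreal" where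
  "state_norm L p f = Lp_norm p (lebesgue_on {- L_max L..<0}) f"

definition X_space :: "real^'N \<Rightarrow> ennreal \<Rightarrow> (real \<Rightarrow> complex^'d) set" where
  "X_space L p =
     {f. f \<in> borel_measurable (lebesgue_on {- L_max L..<0}) \<and> state_norm L p f < \<infinity>}"

definition shifted :: "(real \<Rightarrow> complex^'d) \<Rightarrow> real \<Rightarrow> real \<Rightarrow> complex^'d" where
  "shifted u t = (\<lambda>s. u (s + t))"

definition L_infty :: "((complex^'d^'d)^'N) set \<Rightarrow> (real \<Rightarrow> (complex^'d^'d)^'N) set" where
  "L_infty \<BB> = {A. A \<in> borel_measurable lebesgue \<and> (\<forall>t. A t \<in> \<BB>)}"


section \<open>Exponential type, exponential stability and the maximal Lyapunov exponent\<close>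

definition exponential_type ::
  "real^'N \<Rightarrow> (real \<Rightarrow> (complex^'d^'d)^'N) set \<Rightarrow> ennreal \<Rightarrow> real \<Rightarrow> bool" where
  "exponential_type L \<A> p \<gamma> \<longleftrightarrow>
     (\<forall>\<epsilon>>0. \<exists>K>0. \<forall>A\<in>\<A>. \<forall>u0\<in>X_space L p. \<forall>u. is_solution L A u0 u \<longrightarrow>
        (\<forall>t\<ge>0. state_norm L p (shifted u t)
                 \<le> ennreal (K * exp ((\<gamma> + \<epsilon>) * t)) * state_norm L p u0))"

definition exponentially_stable ::
  "real^'N \<Rightarrow> (real \<Rightarrow> (complex^'d^'d)^'N) set \<Rightarrow> ennreal \<Rightarrow> bool" where
  "exponentially_stable L \<A> p \<longleftrightarrow> (\<exists>\<gamma><0. exponential_type L \<A> p \<gamma>)"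

definition ext_ln :: "ennreal \<Rightarrow> ereal" where
  "ext_ln x = (if x = 0 then -\<infinity> else if x = \<infinity> then \<infinity> else ereal (ln (enn2real x)))"

definition lyapunov_exponent ::
  "real^'N \<Rightarrow> (real \<Rightarrow> (complex^'d^'d)^'N) set \<Rightarrow> ennreal \<Rightarrow> ereal" where
  "lyapunov_exponent L \<A> p =
     Limsup at_top (\<lambda>t::real.
       SUP A\<in>\<A>. SUP u0\<in>{u0 \<in> X_space L p. state_norm L p u0 = 1}. SUP u\<in>{u. is_solution L A u0 u}.
         ext_ln (state_norm L p (shifted u t)) / ereal t)"


section \<open>The quantity \<open>\<mu>\<close>\<close>

definition norm1_nat :: "nat^'N \<Rightarrow> nat" where
  "norm1_nat n = (\<Sum>i\<in>UNIV. n $ i)"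

text \<open>A word \<open>v = (v\<^sub>1, \<dots>, v\<^sub>n)\<close> is a list, and its \<open>k\<close>-th letter \<open>v\<^sub>k\<close> is \<open>v ! (k - 1)\<close>.\<close>

definition p_vec :: "'N list \<Rightarrow> nat \<Rightarrow> nat^'N" where
  "p_vec v k = (\<Sum>j\<in>{1..<k}. axis (v ! (j - 1)) 1)"

definition V_words :: "nat^'N \<Rightarrow> ('N list) set" where
  "V_words n = {v. length v = norm1_nat n \<and> p_vec v (norm1_nat n + 1) = n}"

definition \<L>_set :: "real^'N \<Rightarrow> real set" where
  "\<L>_set \<Lambda> = range (dot_nat \<Lambda>)"

definition \<L>_below :: "real^'N \<Rightarrow> real \<Rightarrow> real set" where
  "\<L>_below \<Lambda> x = \<L>_set \<Lambda> \<inter> {0..<x}"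

definition ordered_prod :: "nat \<Rightarrow> (nat \<Rightarrow> complex^'d^'d) \<Rightarrow> complex^'d^'d" where
  "ordered_prod n X = foldr (\<lambda>k P. X k ** P) [1..<n + 1] (mat 1)"

definition word_sum ::
  "real^'N \<Rightarrow> (real \<Rightarrow> (complex^'d^'d)^'N) \<Rightarrow> real \<Rightarrow> complex^'d^'d" where
  "word_sum \<Lambda> B x =
     (\<Sum>n\<in>{n. dot_nat \<Lambda> n = x}. \<Sum>v\<in>V_words n.
        ordered_prod (norm1_nat n) (\<lambda>k. B (dot_nat \<Lambda> (p_vec v k)) $ (v ! (k - 1))))"

definition mu ::
  "(complex^'d^'d \<Rightarrow> real) \<Rightarrow> real^'N \<Rightarrow> ((complex^'d^'d)^'N) set \<Rightarrow> ereal" where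
  "mu nrm \<Lambda> \<BB> =
     Limsup (inf at_top (principal (\<L>_set \<Lambda>))) (\<lambda>x.
       SUP B\<in>Pi (\<L>_below \<Lambda> x) (\<lambda>_. \<BB>). ereal (nrm (word_sum \<Lambda> B x) powr (1 / x)))"

definition scaled_set ::
  "real^'N \<Rightarrow> real \<Rightarrow> ((complex^'d^'d)^'N) set \<Rightarrow> ((complex^'d^'d)^'N) set" where
  "scaled_set \<Lambda> \<nu> \<BB> = (\<lambda>B. \<chi> j. exp (\<nu> * \<Lambda> $ j) *\<^sub>R (B $ j)) ` \<BB>"

end

theory Submission
  imports Defs
begin

text \<open>
  Iterating the equation expresses \<open>u(t)\<close> through sums over words \<open>v\<close> of ordered products of the
  \<open>A\<^sub>j\<close> taken at the times \<open>t - L \<cdot> p\<^sub>v(k)\<close>. For \<open>L \<in> V_plus \<Lambda>\<close> the \<open>L\<close>-length of a word depends only on its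
  \<open>\<Lambda>\<close>-length \<open>x\<close>, so the words group into classes, and the sum over a class is \<open>word_sum \<Lambda> B x\<close> with
  \<open>B\<^sup>r\<close> the value of \<open>A\<close> at the corresponding time. Only polynomially many classes matter at time \<open>t\<close>,
  hence an exponential bound on the word sums passes to the solutions in every \<open>L\<^sup>p\<close>, at the price of
  an arbitrarily small loss in the exponent.

  Conversely, fix \<open>x\<close> and a family \<open>B\<close>, take \<open>u\<^sub>0\<close> constant equal to \<open>w\<close> on a short interval \<open>[-\<eta>, 0)\<close> and zero
  elsewhere, and let \<open>A = B\<^sup>r\<close> on \<open>[x - r - \<eta>, x - r)\<close>. Since the lengths of words below \<open>x + 1\<close> are
  finitely many, for small \<open>\<eta>\<close> only words of length exactly \<open>x\<close> reach the impulse from \<open>[x - \<eta>, x)\<close>, where therefore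
  \<open>u = word_sum \<Lambda> B x w\<close>. The factor \<open>\<eta>\<^sup>1\<^sup>/\<^sup>p\<close> cancels in the ratio of the norms, so decay of the
  solutions bounds the word sums. Replacing \<open>\<BB>\<close> by \<open>\<BB>\<^sub>-\<^sub>\<nu>\<close> multiplies the word sum at \<open>x\<close> by \<open>exp (-\<nu> x)\<close>, which
  gives the formula for the Lyapunov exponent.
\<close>

section \<open>Words\<close>

definition wlen :: "real^'N \<Rightarrow> 'N list \<Rightarrow> real" where
  "wlen L v = (\<Sum>j\<leftarrow>v. L $ j)"

lemma wlen_simps [simp]:
  "wlen L [] = 0" "wlen L (j # v) = L $ j + wlen L v" "wlen L (v @ w) = wlen L v + wlen L w"
  by (simp_all add: wlen_def)

text \<open>The summand of \<open>word_sum\<close> in recursive form. The running offset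
  \<open>s\<close> is the length of the prefix already read, so that inductions on the word can pass
  to the tail.\<close>

fun path_prod ::
  "real^'N \<Rightarrow> (real \<Rightarrow> (complex^'d^'d)^'N) \<Rightarrow> real \<Rightarrow> 'N list \<Rightarrow> complex^'d^'d" where
  "path_prod L B s [] = mat 1"
| "path_prod L B s (j # v) = B s $ j ** path_prod L B (s + L $ j) v"

text \<open>The Parikh vector of the word.\<close>

definition word_count :: "'N list \<Rightarrow> nat^'N" where
  "word_count v = (\<Sum>j\<leftarrow>v. axis j 1)"

lemma norm1_nat_add: "norm1_nat (m + n) = norm1_nat m + norm1_nat n"
  by (simp add: norm1_nat_def sum.distrib)

lemma norm1_nat_axis: "norm1_nat (axis j 1) = 1"
  by (simp add: norm1_nat_def axis_def)

lemma dot_nat_add: "dot_nat L (m + n) = dot_nat L m + dot_nat L n"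
  by (simp add: dot_nat_def inner_vec_def sum.distrib algebra_simps)

lemma dot_nat_zero [simp]: "dot_nat L 0 = 0"
  by (simp add: dot_nat_def inner_vec_def)

lemma dot_nat_axis: "dot_nat L (axis j 1) = L $ j"
  by (simp add: dot_nat_def inner_vec_def axis_def if_distrib sum.delta cong: if_cong)

lemma word_count_simps [simp]:
  "word_count [] = 0" "word_count (j # v) = axis j 1 + word_count v"
  "word_count (v @ w) = word_count v + word_count w"
  by (simp_all add: word_count_def)

lemma norm1_word_count [simp]: "norm1_nat (word_count v) = length v"
proof (induction v)
  case Nil
  then show ?case by (simp add: norm1_nat_def)
next
  case (Cons j v)
  then show ?case by (simp add: norm1_nat_add norm1_nat_axis del: One_nat_def)
qed

lemma dot_nat_word_count [simp]: "dot_nat L (word_count v) = wlen L v"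
  by (induction v) (simp_all add: dot_nat_add dot_nat_axis del: One_nat_def)

text \<open>Induction on the component sum: one unit is taken from a nonzero component and becomes
  the first letter. With it, \<open>\<L>_set L\<close> turns into the set of lengths of
  words.\<close>

lemma word_count_surj: "\<exists>v. word_count v = n"
proof (induction "norm1_nat n" arbitrary: n)
  case 0
  then have "n = 0" by (simp add: norm1_nat_def vec_eq_iff)
  then show ?case by (intro exI[of _ "[]"]) simp
next
  case (Suc k)
  then obtain i where i: "n $ i \<noteq> 0"
    unfolding norm1_nat_def by (metis Zero_not_Suc sum.neutral)
  define n' where "n' = (\<chi> j. if j = i then n $ j - 1 else n $ j)"
  have n: "n = axis i 1 + n'"
    using i by (auto simp: n'_def vec_eq_iff axis_def)
  then have "norm1_nat n = 1 + norm1_nat n'"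
    by (metis norm1_nat_add norm1_nat_axis)
  with Suc obtain v where "word_count v = n'" by force
  with n show ?case by (intro exI[of _ "i # v"]) simp
qed

lemma p_vec_1 [simp]: "p_vec v (Suc 0) = 0"
  by (simp add: p_vec_def)

text \<open>At \<open>k = 0\<close> the left side would be an empty sum while the right side is
  \<open>axis j 1\<close>, hence the restriction on \<open>k\<close>.\<close>

lemma p_vec_Cons: "k \<ge> 1 \<Longrightarrow> p_vec (j # v) (Suc k) = axis j 1 + p_vec v k"
proof -
  assume k: "k \<ge> 1"
  have "p_vec (j # v) (Suc k) = axis j 1 + (\<Sum>i\<in>{Suc 1..<Suc k}. axis ((j # v) ! (i - 1)) 1)"
    using k unfolding p_vec_def by (subst sum.atLeast_Suc_lessThan) auto
  also have "(\<Sum>i\<in>{Suc 1..<Suc k}. axis ((j # v) ! (i - 1)) (1::nat)) = p_vec v k"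
    unfolding p_vec_def sum.shift_bounds_Suc_ivl
    by (rule sum.cong) (auto simp: nth_Cons split: nat.splits)
  finally show ?thesis .
qed

lemma p_vec_Suc_length: "p_vec v (Suc (length v)) = word_count v"
proof (induction v)
  case (Cons j v)
  then show ?case by (simp add: p_vec_Cons del: One_nat_def)
qed simp

text \<open>Component sums in \<open>word_count v = n\<close> give the length of \<open>v\<close>,
  and for a word of that length the last partial sum \<open>p_vec\<close> counts all
  letters.\<close>

lemma V_words_eq: "V_words n = {v. word_count v = n}"
proof (intro set_eqI)
  fix v :: "'a list"
  have "p_vec v (norm1_nat n + 1) = word_count v" if "length v = norm1_nat n"
    using p_vec_Suc_length[of v] that by simp
  then show "v \<in> V_words n \<longleftrightarrow> v \<in> {v. word_count v = n}"
    using norm1_word_count[of v] by (auto simp: V_words_def)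
qed

lemma ordered_prod_Suc:
  "ordered_prod (Suc n) X = X 1 ** ordered_prod n (\<lambda>k. X (Suc k))"
proof -
  have "[1..<Suc n + 1] = 1 # map Suc [1..<n + 1]"
    by (simp add: upt_conv_Cons map_Suc_upt del: upt_Suc)
  then show ?thesis
    by (simp add: ordered_prod_def foldr_map comp_def del: upt_Suc)
qed

lemma ordered_prod_cong:
  "(\<And>k. 1 \<le> k \<Longrightarrow> k \<le> n \<Longrightarrow> X k = Y k) \<Longrightarrow> ordered_prod n X = ordered_prod n Y"
  unfolding ordered_prod_def by (rule foldr_cong) auto

text \<open>The arbitrary offset \<open>s\<close> carries the induction: dropping the first letter
  \<open>j\<close> moves the start to \<open>s + L $ j\<close>.\<close>

lemma ordered_prod_eq_path_prod:
  "ordered_prod (length v) (\<lambda>k. B (s + dot_nat L (p_vec v k)) $ (v ! (k - 1))) = path_prod L B s v"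
proof (induction v arbitrary: s)
  case Nil
  show ?case by (simp add: ordered_prod_def)
next
  case (Cons j v)
  have "ordered_prod (length v)
          (\<lambda>k. B (s + dot_nat L (p_vec (j # v) (Suc k))) $ ((j # v) ! (Suc k - 1))) =
        ordered_prod (length v)
          (\<lambda>k. B ((s + L $ j) + dot_nat L (p_vec v k)) $ (v ! (k - 1)))"
    by (rule ordered_prod_cong)
       (auto simp: p_vec_Cons dot_nat_add dot_nat_axis add.assoc nth_Cons' simp del: One_nat_def)
  then show ?case
    using Cons.IH[of "s + L $ j"] by (simp add: ordered_prod_Suc)
qed

section \<open>Lengths of words and the word sum\<close>

lemma dot_nat_nonneg:
  "L \<in> pos_delays \<Longrightarrow> 0 \<le> dot_nat L n"
  unfolding dot_nat_def inner_vec_def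
  by (intro sum_nonneg) (simp add: pos_delays_def less_imp_le)

lemma length_times_le_wlen:
  assumes "\<And>j. m \<le> L $ j"
  shows "real (length v) * m \<le> wlen L v"
proof (induction v)
  case (Cons j v)
  then show ?case using assms[of j] by (simp add: algebra_simps)
qed simp

lemma wlen_nonneg: "L \<in> pos_delays \<Longrightarrow> 0 \<le> wlen L v"
  using dot_nat_nonneg[of L "word_count v"] by simp

text \<open>Each letter costs at least the smallest delay \<open>m\<close>, so at most
  \<open>t / m\<close> letters fit, and the alphabet is finite.\<close>

lemma finite_wlen_le:
  assumes "L \<in> pos_delays"
  shows "finite {v. wlen L v \<le> t}"
proof -
  obtain m where m: "0 < m" "\<And>j. m \<le> L $ j"
    using pos_delays_lower_bound[OF assms] by blast
  have "length v \<le> nat \<lfloor>t / m\<rfloor>" if "wlen L v \<le> t" for v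
  proof -
    have "real (length v) * m \<le> t"
      using length_times_le_wlen[of m L v] m that by simp
    then have "real (length v) \<le> t / m" using m by (simp add: field_simps)
    then show ?thesis by linarith
  qed
  then have "{v. wlen L v \<le> t} \<subseteq> {v. set v \<subseteq> UNIV \<and> length v \<le> nat \<lfloor>t / m\<rfloor>}" by auto
  then show ?thesis by (rule finite_subset) (rule finite_lists_length_le, simp)
qed

lemma finite_wlen_eq: "L \<in> pos_delays \<Longrightarrow> finite {v. wlen L v = t}"
  by (rule finite_subset[OF _ finite_wlen_le[of L t]]) auto

lemma \<L>_set_eq: "\<L>_set L = range (wlen L)"
proof -
  have "range word_count = (UNIV :: (nat^'a) set)"
    using word_count_surj by (metis surj_def)
  then have "\<L>_set L = (dot_nat L \<circ> word_count) ` UNIV"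
    unfolding \<L>_set_def by (metis image_comp)
  then show ?thesis by (simp add: comp_def)
qed

text \<open>A word has exactly one Parikh vector, and that vector determines its length. The double
  sum is therefore the sum over words of length \<open>x\<close>, partitioned by Parikh
  vector.\<close>

lemma word_sum_eq:
  assumes "L \<in> pos_delays"
  shows "word_sum L B x = (\<Sum>v | wlen L v = x. path_prod L B 0 v)"
proof -
  have "word_sum L B x = (\<Sum>n\<in>word_count ` {v. wlen L v = x}. \<Sum>v | word_count v = n. path_prod L B 0 v)"
    unfolding word_sum_def V_words_eq
  proof (rule sum.cong)
    show "{n. dot_nat L n = x} = word_count ` {v. wlen L v = x}"
    proof (intro set_eqI)
      fix n :: "nat^'a"
      obtain v where "word_count v = n" using word_count_surj by blast
      then show "n \<in> {n. dot_nat L n = x} \<longleftrightarrow> n \<in> word_count ` {v. wlen L v = x}"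
        by (auto simp flip: dot_nat_word_count)
    qed
  next
    fix n
    show "(\<Sum>v | word_count v = n. ordered_prod (norm1_nat n) (\<lambda>k. B (dot_nat L (p_vec v k)) $ (v ! (k - 1))))
        = (\<Sum>v | word_count v = n. path_prod L B 0 v)"
      using ordered_prod_eq_path_prod[of _ B 0 L] by (intro sum.cong) auto
  qed
  also have "\<dots> = (\<Sum>n\<in>word_count ` {v. wlen L v = x}.
                   \<Sum>v\<in>{v \<in> {v. wlen L v = x}. word_count v = n}. path_prod L B 0 v)"
    by (intro sum.cong refl) (auto, metis dot_nat_word_count)
  also have "\<dots> = (\<Sum>v | wlen L v = x. path_prod L B 0 v)"
    by (rule sum.image_gen[symmetric]) (rule finite_wlen_eq[OF assms])
  finally show ?thesis .
qed

section \<open>Representation of solutions\<close>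

lemma path_prod_shift: "path_prod L B (s + c) v = path_prod L (\<lambda>r. B (r + c)) s v"
proof (induction v arbitrary: s)
  case (Cons j v)
  then show ?case by (metis path_prod.simps(2) add.assoc add.commute)
qed simp

lemma path_prod_append:
  "path_prod L B s (v @ w) = path_prod L B s v ** path_prod L B (s + wlen L v) w"
  by (induction v arbitrary: s) (simp_all add: matrix_mul_assoc add.assoc)

text \<open>The factor of a letter is read at the length of the prefix before it. This is an element
  of \<open>\<L>_set L\<close>, and it is strictly below \<open>x\<close> because the letter itself
  has positive length.\<close>

lemma path_prod_cong:
  assumes "L \<in> pos_delays" "\<And>r. r \<in> \<L>_below L x \<Longrightarrow> B r = B' r" "wlen L w + wlen L v \<le> x"
  shows "path_prod L B (wlen L w) v = path_prod L B' (wlen L w) v"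
  using assms(3)
proof (induction v arbitrary: w)
  case (Cons j v)
  have "wlen L w < x"
  proof -
    have "0 < L $ j" using assms(1) by (simp add: pos_delays_def)
    then show ?thesis using Cons.prems wlen_nonneg[OF assms(1), of v] by simp
  qed
  then have "B (wlen L w) = B' (wlen L w)"
    using wlen_nonneg[OF assms(1)] by (intro assms(2)) (auto simp: \<L>_below_def \<L>_set_eq)
  then show ?case using Cons.IH[of "w @ [j]"] Cons.prems by simp
qed simp

section \<open>Matrix products as bounded bilinear maps\<close>

lemma bounded_bilinear_matrix_vector_mult:
  "bounded_bilinear (\<lambda>(M::complex^'n^'m) w. M *v w)"
  unfolding bilinear_conv_bounded_bilinear[symmetric] bilinear_def
  by (intro conjI allI linearI; simp add: matrix_vector_mult_def vec_eq_iff)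
     (simp_all add: sum.distrib ring_distribs scaleR_right.sum)

lemma bounded_bilinear_matrix_mult:
  "bounded_bilinear (\<lambda>(M::complex^'n^'m) (P::complex^'k^'n). M ** P)"
  unfolding bilinear_conv_bounded_bilinear[symmetric] bilinear_def
  by (intro conjI allI linearI; simp add: matrix_matrix_mult_def vec_eq_iff)
     (simp_all add: sum.distrib ring_distribs scaleR_right.sum)

lemma matrix_vector_mult_sum_left:
  "(\<Sum>i\<in>I. M i) *v (w::complex^'n) = (\<Sum>i\<in>I. M i *v w)"
  by (rule bounded_bilinear.sum_left[OF bounded_bilinear_matrix_vector_mult])

lemma matrix_vector_mult_sum_right:
  "(M::complex^'n^'m) *v (\<Sum>i\<in>I. w i) = (\<Sum>i\<in>I. M *v w i)"
  by (rule bounded_bilinear.sum_right[OF bounded_bilinear_matrix_vector_mult])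

text \<open>The entries of \<open>M\<close> are the components of its columns
  \<open>M *v axis j 1\<close>, and the factor counts the entries. So crude a constant is harmless
  where only exponential rates matter.\<close>

lemma norm_le_of_mult_vec_le:
  fixes M :: "complex^'n^'m"
  assumes "\<And>j. norm (M *v axis j 1) \<le> a"
  shows "norm M \<le> real CARD('m) * real CARD('n) * a"
proof -
  have "norm (M $ i $ j) \<le> a" for i j
  proof -
    have "M $ i $ j = (M *v axis j 1) $ i"
      by (simp add: matrix_vector_mult_def axis_def if_distrib sum.delta cong: if_cong)
    then show ?thesis
      using Finite_Cartesian_Product.norm_nth_le[of "M *v axis j 1" i] assms[of j] by simp
  qed
  then have "norm (M $ i) \<le> real CARD('n) * a" for i
    unfolding norm_vec_def
    by (intro order_trans[OF L2_set_le_sum] order_trans[OF sum_bounded_above[of _ _ a]]) auto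
  then have "norm M \<le> (\<Sum>i\<in>(UNIV::'m set). real CARD('n) * a)"
    unfolding norm_vec_def[of M] by (intro order_trans[OF L2_set_le_sum] sum_mono) auto
  then show ?thesis by simp
qed

section \<open>Unrolling the delay recursion\<close>

definition zero_ext :: "real^'N \<Rightarrow> (real \<Rightarrow> complex^'d) \<Rightarrow> real \<Rightarrow> complex^'d" where
  "zero_ext L u0 s = (if - L_max L \<le> s \<and> s < 0 then u0 s else 0)"

lemma le_L_max: "L $ j \<le> L_max L"
  unfolding L_max_def by (rule Max_ge) auto

lemma L_max_pos: "L \<in> pos_delays \<Longrightarrow> 0 < L_max L"
  using le_L_max[of L undefined] less_le_trans by (fastforce simp: pos_delays_def)

lemma wlen_le_split:
  assumes "0 \<le> t"
  shows "{v. wlen L v \<le> t} = insert [] (\<Union>j. (#) j ` {v. wlen L v \<le> t - L $ j})"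
proof (intro set_eqI)
  fix v show "v \<in> {v. wlen L v \<le> t} \<longleftrightarrow> v \<in> insert [] (\<Union>j. (#) j ` {v. wlen L v \<le> t - L $ j})"
    using assms by (cases v) (auto simp: image_iff algebra_simps)
qed

text \<open>Past time 0 the solution is driven by a source, namely the delayed terms that still see
  the initial datum. Iteration sends this source along all words \<open>v\<close> of delays with
  total length at most \<open>t\<close>. Setting the left side to 0 for \<open>t < 0\<close> matches
  the empty sum and lets the recursion run without boundary cases.\<close>

lemma solution_representation:
  assumes L: "L \<in> pos_delays" and u: "is_solution L A u0 u"
  shows "(if t < 0 then 0 else u t) =
    (\<Sum>v | wlen L v \<le> t. path_prod L (\<lambda>r. A (t - r)) 0 v *v
       (\<Sum>j\<in>UNIV. A (t - wlen L v) $ j *v zero_ext L u0 (t - wlen L v - L $ j)))"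
proof -
  obtain m where m: "0 < m" "\<And>j. m \<le> L $ j"
    using pos_delays_lower_bound[OF L] by blast
  define h where "h s = (\<Sum>j\<in>UNIV. A s $ j *v zero_ext L u0 (s - L $ j))" for s
  define U where "U t = (if t < 0 then 0 else u t)" for t
  have U_rec: "U t = h t + (\<Sum>j\<in>UNIV. A t $ j *v U (t - L $ j))" if "0 \<le> t" for t
  proof -
    \<comment> \<open>The argument is at least \<open>- L_max L\<close>: if it is negative,
      \<open>zero_ext\<close> supplies the value and \<open>U\<close> vanishes; otherwise the roles
      are exchanged.\<close>
    have "u (t - L $ j) = zero_ext L u0 (t - L $ j) + U (t - L $ j)" for j
      using u le_L_max[of L j] that by (auto simp: U_def zero_ext_def is_solution_def)
    then have "A t $ j *v u (t - L $ j) = A t $ j *v zero_ext L u0 (t - L $ j) + A t $ j *v U (t - L $ j)" for j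
      by (simp add: matrix_vector_right_distrib)
    then show ?thesis using u that by (simp add: is_solution_def U_def h_def sum.distrib)
  qed
  have "U t = (\<Sum>v | wlen L v \<le> t. path_prod L (\<lambda>r. A (t - r)) 0 v *v h (t - wlen L v))"
  \<comment> \<open>The measure is the one used for the existence of solutions: it drops when a
    nonnegative \<open>t\<close> is lowered by a delay.\<close>
  proof (induction "nat (\<lfloor>t / m\<rfloor> + 1)" arbitrary: t rule: less_induct)
    case less
    show ?case
    proof (cases "t < 0")
      case True
      then have "{v. wlen L v \<le> t} = {}"
        using wlen_nonneg[OF L] by (auto simp: not_le intro: less_le_trans)
      then show ?thesis using True by (simp add: U_def)
    next
      case False
      let ?g = "\<lambda>t v. path_prod L (\<lambda>r. A (t - r)) 0 v *v h (t - wlen L v)"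
      have shift: "path_prod L (\<lambda>r. A (t - r)) (L $ j) v = path_prod L (\<lambda>r. A (t - L $ j - r)) 0 v" for j v
        using path_prod_shift[of L "\<lambda>r. A (t - r)" 0 "L $ j" v] by (simp add: algebra_simps)
      have fin: "finite {v. wlen L v \<le> s}" for s by (rule finite_wlen_le[OF L])
      \<comment> \<open>Words are split by their first letter: the empty word gives the source at
        time \<open>t\<close>, and the words beginning with \<open>j\<close> recombine into
        \<open>A t $ j *v U (t - L $ j)\<close>.\<close>
      have "(\<Sum>v | wlen L v \<le> t. ?g t v) =
          ?g t [] + (\<Sum>v\<in>(\<Union>j. (#) j ` {v. wlen L v \<le> t - L $ j}). ?g t v)"
        using False by (subst wlen_le_split) (simp, intro sum.insert, auto intro!: fin)
      also have "(\<Sum>v\<in>(\<Union>j. (#) j ` {v. wlen L v \<le> t - L $ j}). ?g t v) =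
          (\<Sum>j\<in>UNIV. \<Sum>v\<in>(#) j ` {v. wlen L v \<le> t - L $ j}. ?g t v)"
        by (rule sum.UNION_disjoint) (auto intro!: fin)
      also have "\<dots> = (\<Sum>j\<in>UNIV. \<Sum>v | wlen L v \<le> t - L $ j. ?g t (j # v))"
        by (rule sum.cong[OF refl]) (subst sum.reindex, auto)
      also have "\<dots> = (\<Sum>j\<in>UNIV. A t $ j *v U (t - L $ j))"
      proof (intro sum.cong refl)
        fix j
        have "(\<Sum>v | wlen L v \<le> t - L $ j. ?g t (j # v)) =
            (\<Sum>v | wlen L v \<le> t - L $ j. A t $ j *v ?g (t - L $ j) v)"
          by (intro sum.cong refl) (simp add: shift algebra_simps flip: matrix_vector_mul_assoc)
        also have "\<dots> = A t $ j *v U (t - L $ j)"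
          using False less[OF step_measure_decreases[OF m(1) m(2)]]
          by (simp add: matrix_vector_mult_sum_right)
        finally show "(\<Sum>v | wlen L v \<le> t - L $ j. ?g t (j # v)) = A t $ j *v U (t - L $ j)" .
      qed
      finally show ?thesis using U_rec[of t] False by simp
    qed
  qed
  then show ?thesis by (simp add: U_def h_def)
qed

section \<open>Grouping words by their \<open>\<Lambda>\<close>-length\<close>

lemma V_plus_wlen_eq:
  assumes "L \<in> V_plus \<Lambda>" "wlen \<Lambda> v = wlen \<Lambda> w"
  shows "wlen L v = wlen L w"
proof -
  define n :: "int^'a" where "n = (\<chi> i. int (word_count v $ i) - int (word_count w $ i))"
  have n: "dot_int M n = wlen M v - wlen M w" for M
    by (simp add: dot_int_def n_def inner_vec_def dot_nat_def algebra_simps sum_subtractf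
             flip: dot_nat_word_count)
  \<comment> \<open>The difference of the Parikh vectors is an integer relation between the
    components of \<open>\<Lambda>\<close>, hence also between those of \<open>L\<close>.\<close>
  have "n \<in> Z_set \<Lambda>" using assms n by (simp add: Z_set_def)
  then have "n \<in> Z_set L" using assms by (auto simp: V_plus_def)
  then show ?thesis using n by (simp add: Z_set_def)
qed

text \<open>\<open>class_len \<Lambda> L\<close> sends the \<open>\<Lambda>\<close>-length of a word to its \<open>L\<close>-length; this is well defined
  because \<open>L \<in> V_plus \<Lambda>\<close>.\<close>

definition class_len :: "real^'N \<Rightarrow> real^'N \<Rightarrow> real \<Rightarrow> real" where
  "class_len \<Lambda> L x = wlen L (SOME v. wlen \<Lambda> v = x)"

lemma class_len_wlen: "L \<in> V_plus \<Lambda> \<Longrightarrow> class_len \<Lambda> L (wlen \<Lambda> v) = wlen L v"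
  unfolding class_len_def by (rule V_plus_wlen_eq) (auto intro: someI)

text \<open>The offset has the form of the length of a prefix \<open>w\<close>, since
  \<open>class_len\<close> is controlled only at lengths of words; reading the letter
  \<open>j\<close> replaces \<open>w\<close> by \<open>w @ [j]\<close>.\<close>

lemma path_prod_class_len:
  assumes "L \<in> V_plus \<Lambda>"
  shows "path_prod \<Lambda> (\<lambda>r. B (class_len \<Lambda> L r)) (wlen \<Lambda> w) v = path_prod L B (wlen L w) v"
proof (induction v arbitrary: w)
  case (Cons j v)
  then show ?case using Cons.IH[of "w @ [j]"] by (simp add: class_len_wlen[OF assms])
qed simp

text \<open>All words of one \<open>\<Lambda>\<close>-length share their \<open>L\<close>-length. So
  the source factors out of each class, and a class with one member of \<open>L\<close>-length at
  most \<open>t\<close> lies below \<open>t\<close> entirely, which makes its sum a complete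
  \<open>word_sum\<close>.\<close>

lemma solution_class_representation:
  assumes \<Lambda>: "\<Lambda> \<in> pos_delays" and L: "L \<in> V_plus \<Lambda>" and u: "is_solution L A u0 u" and "0 \<le> t"
  shows "u t = (\<Sum>x\<in>wlen \<Lambda> ` {v. wlen L v \<le> t}. word_sum \<Lambda> (\<lambda>r. A (t - class_len \<Lambda> L r)) x *v
       (\<Sum>j\<in>UNIV. A (t - class_len \<Lambda> L x) $ j *v zero_ext L u0 (t - class_len \<Lambda> L x - L $ j)))"
proof -
  have L': "L \<in> pos_delays" using L by (simp add: V_plus_def)
  define h where "h s = (\<Sum>j\<in>UNIV. A s $ j *v zero_ext L u0 (s - L $ j))" for s
  let ?g = "\<lambda>v. path_prod L (\<lambda>r. A (t - r)) 0 v *v h (t - wlen L v)"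
  have "u t = (\<Sum>v | wlen L v \<le> t. ?g v)"
    using solution_representation[OF L' u, of t] \<open>0 \<le> t\<close> by (simp add: h_def)
  also have "\<dots> = (\<Sum>x\<in>wlen \<Lambda> ` {v. wlen L v \<le> t}. \<Sum>v\<in>{v \<in> {v. wlen L v \<le> t}. wlen \<Lambda> v = x}. ?g v)"
    by (rule sum.image_gen) (rule finite_wlen_le[OF L'])
  also have "\<dots> = (\<Sum>x\<in>wlen \<Lambda> ` {v. wlen L v \<le> t}.
      word_sum \<Lambda> (\<lambda>r. A (t - class_len \<Lambda> L r)) x *v h (t - class_len \<Lambda> L x))"
  proof (intro sum.cong refl)
    fix x assume "x \<in> wlen \<Lambda> ` {v. wlen L v \<le> t}"
    then obtain w where w: "wlen L w \<le> t" "x = wlen \<Lambda> w" by blast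
    then have "{v \<in> {v. wlen L v \<le> t}. wlen \<Lambda> v = x} = {v. wlen \<Lambda> v = x}"
      by (metis (mono_tags, lifting) V_plus_wlen_eq[OF L] mem_Collect_eq)
    moreover have "?g v = path_prod \<Lambda> (\<lambda>r. A (t - class_len \<Lambda> L r)) 0 v *v h (t - class_len \<Lambda> L x)"
      if "wlen \<Lambda> v = x" for v
    proof -
      have "path_prod \<Lambda> (\<lambda>r. A (t - class_len \<Lambda> L r)) 0 v = path_prod L (\<lambda>r. A (t - r)) 0 v"
        using path_prod_class_len[OF L, of "\<lambda>r. A (t - r)" "[]" v] by simp
      moreover have "class_len \<Lambda> L x = wlen L v"
        using class_len_wlen[OF L, of v] that by simp
      ultimately show ?thesis by (simp only:)
    qed
    ultimately show "(\<Sum>v\<in>{v \<in> {v. wlen L v \<le> t}. wlen \<Lambda> v = x}. ?g v) =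
        word_sum \<Lambda> (\<lambda>r. A (t - class_len \<Lambda> L r)) x *v h (t - class_len \<Lambda> L x)"
      by (simp add: word_sum_eq[OF \<Lambda>] matrix_vector_mult_sum_left)
  qed
  finally show ?thesis by (simp add: h_def)
qed

section \<open>The \<open>L\<^sup>p\<close> norms\<close>

lemma measurable_lebesgue_translation: "(\<lambda>x::real. x + c) \<in> lebesgue \<rightarrow>\<^sub>M lebesgue"
  using lebesgue_affine_measurable[of "\<lambda>_. 1" c] by (simp add: add.commute)

lemma distr_lebesgue_translation: "distr lebesgue lebesgue (\<lambda>x::real. x + c) = lebesgue"
  using lebesgue_real_affine[of 1 c] by (simp add: add.commute density_1)

lemma borel_measurable_lebesgue_translation:
  "f \<in> borel_measurable lebesgue \<Longrightarrow> (\<lambda>x::real. f (x + c)) \<in> borel_measurable lebesgue"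
  using measurable_compose[OF measurable_lebesgue_translation] .

lemma borel_measurable_mult_vec:
  fixes M :: "'a \<Rightarrow> complex^'n^'m"
  assumes "M \<in> borel_measurable N" "w \<in> borel_measurable N"
  shows "(\<lambda>s. M s *v w s) \<in> borel_measurable N"
  using assms
  by (rule borel_measurable_continuous_Pair)
     (intro bounded_bilinear.continuous_on[OF bounded_bilinear_matrix_vector_mult] continuous_intros)

lemma borel_measurable_vec_component:
  assumes "A \<in> borel_measurable N"
  shows "(\<lambda>s. (A s :: 'a::{euclidean_space}^'n) $ j) \<in> borel_measurable N"
  by (rule borel_measurable_continuous_on[OF _ assms]) (intro continuous_intros)

text \<open>Moves estimates for finite \<open>p\<close> to the integral, where sums and translations
  are easy to handle.\<close>

lemma Lp_norm_le_iff:
  assumes "1 \<le> p" "p \<noteq> \<infinity>" "0 \<le> \<beta>"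
  shows "Lp_norm p M f \<le> ennreal \<beta> \<longleftrightarrow>
    (\<integral>\<^sup>+ s. ennreal (norm (f s) powr enn2real p) \<partial>M) \<le> ennreal (\<beta> powr enn2real p)"
proof -
  define r where "r = enn2real p"
  have r: "r \<ge> 1"
    using assms(1,2) enn2real_mono[of 1 p] by (simp add: r_def less_top)
  define I where "I = (\<integral>\<^sup>+ s. ennreal (norm (f s) powr r) \<partial>M)"
  show ?thesis
  proof (cases "I = \<infinity>")
    case True
    then show ?thesis
      using assms(2) by (simp add: Lp_norm_def Let_def top_unique flip: r_def I_def)
  next
    case False
    then obtain J where J: "I = ennreal J" "0 \<le> J" by (cases I) auto
    have "J powr (1 / r) \<le> \<beta> \<longleftrightarrow> J \<le> \<beta> powr r"
    proof
      assume "J powr (1 / r) \<le> \<beta>"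
      then have "(J powr (1 / r)) powr r \<le> \<beta> powr r"
        using r by (intro powr_mono2) auto
      then show "J \<le> \<beta> powr r" using r J by (simp add: powr_powr)
    next
      assume "J \<le> \<beta> powr r"
      then have "J powr (1 / r) \<le> (\<beta> powr r) powr (1 / r)"
        using r J by (intro powr_mono2) auto
      then show "J powr (1 / r) \<le> \<beta>" using r assms(3) by (simp add: powr_powr)
    qed
    then show ?thesis
      using assms(2,3) J by (simp add: Lp_norm_def Let_def flip: r_def I_def)
  qed
qed

text \<open>The index \<open>i\<close> may vary with \<open>s\<close>, so the \<open>p\<close>-th
  power of \<open>norm (f s)\<close> is bounded by the sum over \<open>I\<close> of the powers of
  \<open>c * norm (g i s)\<close>. This costs the \<open>p\<close>-th root of \<open>card I\<close>,
  which is at most \<open>card I\<close> for every \<open>p\<close>.\<close>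

lemma Lp_norm_le_of_pointwise:
  assumes p: "1 \<le> p" and I: "finite I" "I \<noteq> {}" and "0 \<le> c"
    and f: "f \<in> borel_measurable M" and g: "\<And>i. i \<in> I \<Longrightarrow> g i \<in> borel_measurable M"
    and le: "\<And>s. s \<in> space M \<Longrightarrow> \<exists>i\<in>I. norm (f s) \<le> c * norm (g i s)"
    and a: "\<And>i. i \<in> I \<Longrightarrow> Lp_norm p M (g i) \<le> a" "a < \<infinity>"
  shows "Lp_norm p M f \<le> ennreal (c * card I) * a"
proof -
  obtain \<alpha> where \<alpha>: "a = ennreal \<alpha>" "0 \<le> \<alpha>" using a(2) by (cases a) auto
  have card: "1 \<le> real (card I)" using I by (simp add: Suc_le_eq card_gt_0_iff)
  have "Lp_norm p M f \<le> ennreal (c * card I * \<alpha>)"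
  proof (cases "p = \<infinity>")
    case True
    have "AE s in M. ennreal (norm (g i s)) \<le> a" if "i \<in> I" for i
      using esssup_AE[of "\<lambda>s. ennreal (norm (g i s))" M] a(1)[OF that] True
      by (auto simp: Lp_norm_def elim: eventually_mono)
    then have "AE s in M. \<forall>i\<in>I. ennreal (norm (g i s)) \<le> a"
      using I(1) by (simp add: AE_finite_all)
    moreover have "AE s in M. s \<in> space M" by simp
    ultimately have "AE s in M. ennreal (norm (f s)) \<le> ennreal (c * card I * \<alpha>)"
    proof eventually_elim
      case (elim s)
      obtain i where i: "i \<in> I" "norm (f s) \<le> c * norm (g i s)" using le elim by blast
      have "norm (g i s) \<le> \<alpha>" using elim i \<alpha> by simp
      then have "c * norm (g i s) \<le> c * (card I * \<alpha>)"
        using \<open>0 \<le> c\<close> card \<alpha>(2) mult_right_mono[of 1 "real (card I)" \<alpha>] by (intro mult_left_mono) auto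
      then show ?case using i by (intro ennreal_leI) (simp add: mult.assoc)
    qed
    then show ?thesis
      using True f by (auto simp: Lp_norm_def intro!: esssup_I)
  next
    case False
    define r where "r = enn2real p"
    have r: "r \<ge> 1" using p False enn2real_mono[of 1 p] by (simp add: r_def less_top)
    have "(\<integral>\<^sup>+ s. ennreal (norm (f s) powr r) \<partial>M)
        \<le> (\<integral>\<^sup>+ s. (\<Sum>i\<in>I. ennreal (c powr r) * ennreal (norm (g i s) powr r)) \<partial>M)"
    proof (rule nn_integral_mono)
      fix s assume "s \<in> space M"
      then obtain i where i: "i \<in> I" "norm (f s) \<le> c * norm (g i s)" using le by blast
      have "norm (f s) powr r \<le> (c * norm (g i s)) powr r"
        using i r by (intro powr_mono2) auto
      also have "\<dots> = c powr r * norm (g i s) powr r"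
        using \<open>0 \<le> c\<close> by (simp add: powr_mult)
      finally have "ennreal (norm (f s) powr r) \<le> ennreal (c powr r) * ennreal (norm (g i s) powr r)"
        by (simp add: ennreal_leI flip: ennreal_mult)
      also have "\<dots> \<le> (\<Sum>i\<in>I. ennreal (c powr r) * ennreal (norm (g i s) powr r))"
        using I(1) i(1) by (intro member_le_sum) auto
      finally show "ennreal (norm (f s) powr r) \<le> \<dots>" .
    qed
    also have "\<dots> = (\<Sum>i\<in>I. ennreal (c powr r) * (\<integral>\<^sup>+ s. ennreal (norm (g i s) powr r) \<partial>M))"
      using g by (subst nn_integral_sum) (auto intro!: sum.cong nn_integral_cmult)
    also have "\<dots> \<le> (\<Sum>i\<in>I. ennreal (c powr r) * ennreal (\<alpha> powr r))"
      using a(1) \<alpha> p False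
      by (intro sum_mono mult_left_mono) (auto simp: Lp_norm_le_iff r_def)
    also have "\<dots> = ennreal (card I * (c powr r * \<alpha> powr r))"
      by (simp add: ennreal_mult ennreal_of_nat_eq_real_of_nat)
    also have "\<dots> \<le> ennreal ((c * card I * \<alpha>) powr r)"
    proof (rule ennreal_leI)
      have "real (card I) powr 1 \<le> real (card I) powr r"
        using card r by (intro powr_mono) auto
      then have "card I * (c powr r * \<alpha> powr r) \<le> card I powr r * (c powr r * \<alpha> powr r)"
        using card by (intro mult_right_mono) auto
      then show "card I * (c powr r * \<alpha> powr r) \<le> (c * card I * \<alpha>) powr r"
        using \<open>0 \<le> c\<close> \<alpha> by (simp add: powr_mult mult_ac)
    qed
    finally show ?thesis
      using \<open>0 \<le> c\<close> \<alpha> False p by (subst Lp_norm_le_iff) (auto simp: r_def)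
  qed
  then show ?thesis using \<open>0 \<le> c\<close> \<alpha> by (simp add: ennreal_mult)
qed

text \<open>Extend \<open>f\<close> by zero to the line, translate there, where Lebesgue measure is
  invariant, and restrict back to \<open>S\<close>; the restriction can only lose mass.\<close>

lemma Lp_norm_translation_le:
  fixes f :: "real \<Rightarrow> 'a::euclidean_space"
  assumes p: "1 \<le> p" and S: "S \<in> sets lebesgue" and f: "f \<in> borel_measurable (lebesgue_on S)"
  shows "Lp_norm p (lebesgue_on S) (\<lambda>s. if s + c \<in> S then f (s + c) else 0) \<le> Lp_norm p (lebesgue_on S) f"
proof (cases "Lp_norm p (lebesgue_on S) f")
  case top
  then show ?thesis by simp
next
  case (real \<beta>)
  define F where "F s = (if s \<in> S then f s else 0)" for s
  have F: "F \<in> borel_measurable lebesgue"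
    unfolding F_def using f S by (rule borel_measurable_if_I)
  have Fc: "(\<lambda>s. F (s + c)) \<in> borel_measurable lebesgue"
    using F by (rule borel_measurable_lebesgue_translation)
  have "Lp_norm p (lebesgue_on S) (\<lambda>s. F (s + c)) \<le> ennreal \<beta>"
  proof (cases "p = \<infinity>")
    case True
    have "AE s in lebesgue_on S. ennreal (norm (f s)) \<le> ennreal \<beta>"
      using esssup_AE[of "\<lambda>s. ennreal (norm (f s))" "lebesgue_on S"] real True
      by (simp add: Lp_norm_def)
    then have "AE s in lebesgue. ennreal (norm (F s)) \<le> ennreal \<beta>"
      using S by (subst (asm) AE_restrict_space_iff) (auto simp: F_def elim!: eventually_mono)
    then have "AE s in lebesgue. ennreal (norm (F (s + c))) \<le> ennreal \<beta>"
      by (intro AE_distrD[OF measurable_lebesgue_translation]) (simp only: distr_lebesgue_translation)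
    then have "AE s in lebesgue_on S. ennreal (norm (F (s + c))) \<le> ennreal \<beta>"
      using S by (subst AE_restrict_space_iff) (auto elim: eventually_mono)
    then show ?thesis
      using True measurable_restrict_space1[OF Fc, of S] by (auto simp: Lp_norm_def intro!: esssup_I)
  next
    case False
    define r where "r = enn2real p"
    define G where "G s = ennreal (norm (F s) powr r)" for s
    have G: "G \<in> borel_measurable lebesgue" unfolding G_def using F by measurable
    have "(\<integral>\<^sup>+ s. G (s + c) \<partial>lebesgue_on S) = (\<integral>\<^sup>+ s. G (s + c) * indicator S s \<partial>lebesgue)"
      using S by (subst nn_integral_restrict_space) auto
    also have "\<dots> \<le> (\<integral>\<^sup>+ s. G (s + c) \<partial>lebesgue)"
      by (intro nn_integral_mono) (auto split: split_indicator)
    also have "\<dots> = (\<integral>\<^sup>+ s. G s \<partial>lebesgue)"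
      using nn_integral_real_affine_lebesgue[OF G, of 1 c] by (simp add: add.commute)
    also have "\<dots> = (\<integral>\<^sup>+ s. ennreal (norm (f s) powr r) * indicator S s \<partial>lebesgue)"
      by (intro nn_integral_cong) (auto simp: G_def F_def split: split_indicator)
    also have "\<dots> = (\<integral>\<^sup>+ s. ennreal (norm (f s) powr r) \<partial>lebesgue_on S)"
      using S by (subst nn_integral_restrict_space) auto
    also have "\<dots> \<le> ennreal (\<beta> powr r)"
      using real p False Lp_norm_le_iff[of p \<beta> "lebesgue_on S" f] by (simp add: r_def)
    finally show ?thesis
      using real p False by (subst Lp_norm_le_iff) (auto simp: G_def r_def)
  qed
  then show ?thesis using real by (simp add: F_def)
qed

text \<open>The factor \<kappa> is 1 for \<open>p = \<infinity>\<close> and \<eta>^(1/p) otherwise.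
  One factor serves all \<open>w\<close>, so it cancels when two impulses of the same width are
  compared.\<close>

lemma Lp_norm_impulse:
  assumes p: "1 \<le> p" and S: "S \<in> sets lebesgue" and J: "{a..<a + \<eta>} \<subseteq> S" "0 < \<eta>"
  obtains \<kappa> where "0 < \<kappa>"
    "\<And>w :: 'a::euclidean_space. Lp_norm p (lebesgue_on S) (\<lambda>s. if s \<in> {a..<a + \<eta>} then w else 0) = ennreal (norm w * \<kappa>)"
proof (cases "p = \<infinity>")
  case True
  have "esssup (lebesgue_on S) (\<lambda>s. ennreal (norm (if s \<in> {a..<a + \<eta>} then w else 0))) = ennreal (norm w)"
    (is "esssup _ ?f = _") for w :: 'a
  proof (rule antisym)
    have m: "?f \<in> borel_measurable (lebesgue_on S)"
    proof -
      have "?f = (\<lambda>s. if s \<in> {a..<a + \<eta>} then ennreal (norm w) else 0)" by auto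
      also have "\<dots> \<in> borel_measurable (lebesgue_on S)"
        by (intro measurable_restrict_space1 measurable_If_set) auto
      finally show ?thesis .
    qed
    then show "esssup (lebesgue_on S) ?f \<le> ennreal (norm w)"
      by (intro esssup_I) auto
    show "ennreal (norm w) \<le> esssup (lebesgue_on S) ?f"
    \<comment> \<open>If the essential supremum were smaller than \<open>norm w\<close>, the
      interval carrying the impulse would be a null set.\<close>
    proof (rule ccontr)
      assume neg: "\<not> ennreal (norm w) \<le> esssup (lebesgue_on S) ?f"
      have "AE s in lebesgue. s \<in> S \<longrightarrow> ?f s \<le> esssup (lebesgue_on S) ?f"
        using esssup_AE[of ?f "lebesgue_on S"] S by (simp add: AE_restrict_space_iff)
      then have "AE s in lebesgue. s \<notin> {a..<a + \<eta>}"
        using neg J(1) by (auto elim!: eventually_mono split: if_splits)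
      then have "emeasure lebesgue {a..<a + \<eta>} = 0"
        by (subst (asm) AE_iff_measurable[of "{a..<a + \<eta>}"]) auto
      then show False using J(2) by simp
    qed
  qed
  then show ?thesis using that[of 1] True by (simp add: Lp_norm_def)
next
  case False
  define r where "r = enn2real p"
  have r: "r \<ge> 1" using p False enn2real_mono[of 1 p] by (simp add: r_def less_top)
  have "(\<integral>\<^sup>+ s. ennreal (norm (if s \<in> {a..<a + \<eta>} then w else 0) powr r) \<partial>lebesgue_on S)
      = ennreal (norm w powr r * \<eta>)" for w :: 'a
  proof -
    have "(\<integral>\<^sup>+ s. ennreal (norm (if s \<in> {a..<a + \<eta>} then w else 0) powr r) \<partial>lebesgue_on S)
      = (\<integral>\<^sup>+ s. ennreal (norm w powr r) * indicator {a..<a + \<eta>} s \<partial>lebesgue)"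
      using S J(1) by (subst nn_integral_restrict_space) (auto intro!: nn_integral_cong split: split_indicator)
    also have "\<dots> = ennreal (norm w powr r * \<eta>)"
      using J(2) by (subst nn_integral_cmult_indicator) (auto simp: ennreal_mult)
    finally show ?thesis .
  qed
  then have "Lp_norm p (lebesgue_on S) (\<lambda>s. if s \<in> {a..<a + \<eta>} then w else 0) = ennreal (norm w * \<eta> powr (1 / r))"
    for w :: 'a
    using False r J(2) by (simp add: Lp_norm_def Let_def powr_mult powr_powr flip: r_def)
  then show ?thesis using that[of "\<eta> powr (1 / r)"] J(2) by simp
qed

section \<open>Measurability of solutions\<close>

lemma solution_measurable:
  assumes L: "L \<in> pos_delays" and u: "is_solution L A u0 u"
    and A: "A \<in> borel_measurable lebesgue"
    and u0: "u0 \<in> borel_measurable (lebesgue_on {- L_max L..<0})" and "0 \<le> t"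
  shows "shifted u t \<in> borel_measurable (lebesgue_on {- L_max L..<0})"
proof -
  obtain m where m: "0 < m" "\<And>j. m \<le> L $ j"
    using pos_delays_lower_bound[OF L] by blast
  \<comment> \<open>Method of steps: \<open>U k\<close> is the solution cut off at time
    \<open>k * m\<close>. Since every delay is at least \<open>m\<close>, the values before
    \<open>(k + 1) * m\<close> are computed from \<open>U k\<close> alone.\<close>
  define U where "U k s = (if - L_max L \<le> s \<and> s < real k * m then u s else 0)" for k s
  have "U 0 = (\<lambda>s. if s \<in> {- L_max L..<0} then u0 s else 0)"
    using u by (auto simp: U_def is_solution_def fun_eq_iff)
  then have U0: "U 0 \<in> borel_measurable lebesgue"
    using borel_measurable_if_I[OF u0] by simp
  have U: "U k \<in> borel_measurable lebesgue" for k
  proof (induction k)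
    case 0
    show ?case by (rule U0)
  next
    case (Suc k)
    have "U (Suc k) = (\<lambda>s. if s \<in> {..<0} then U 0 s else
        if s \<in> {..<real (Suc k) * m} then \<Sum>j\<in>UNIV. A s $ j *v U k (s + - L $ j) else 0)"
    proof
      fix s
      show "U (Suc k) s = (if s \<in> {..<0} then U 0 s else
        if s \<in> {..<real (Suc k) * m} then \<Sum>j\<in>UNIV. A s $ j *v U k (s + - L $ j) else 0)"
      proof (cases "0 \<le> s \<and> s < real (Suc k) * m")
        case True
        have "U k (s + - L $ j) = u (s - L $ j)" for j
          using True m(2)[of j] le_L_max[of L j] by (auto simp: U_def algebra_simps)
        then show ?thesis
          using True u L_max_pos[OF L] by (simp add: U_def is_solution_def)
      next
        case False
        moreover have "0 \<le> m + real k * m" using m(1) by simp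
        ultimately show ?thesis by (auto simp: U_def algebra_simps)
      qed
    qed
    also have "\<dots> \<in> borel_measurable lebesgue"
      by (intro measurable_If_set borel_measurable_sum U0 borel_measurable_mult_vec
          borel_measurable_vec_component A borel_measurable_lebesgue_translation[OF Suc.IH]) auto
    finally show ?case .
  qed
  obtain k where k: "t / m < real k" using reals_Archimedean2 by blast
  then have "t < real k * m" using m(1) by (simp add: field_simps)
  then have "shifted u t s = U k (s + t)" if "s \<in> {- L_max L..<0}" for s
    using that \<open>0 \<le> t\<close> by (auto simp: shifted_def U_def)
  then show ?thesis
    using measurable_restrict_space1[OF borel_measurable_lebesgue_translation[OF U[of k], of t]]
    by (subst measurable_cong[of _ _ "\<lambda>s. U k (s + t)"]) auto
qed

section \<open>Growth of solutions\<close>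

text \<open>The \<open>\<Lambda>\<close>-length depends only on the Parikh vector, whose components
  are at most \<open>t / m\<close>. The classes thus grow polynomially in \<open>t\<close>, although
  the words themselves may grow exponentially in number.\<close>

lemma card_length_classes_le:
  fixes L \<Lambda> :: "real^'N"
  assumes L: "L \<in> pos_delays" and m: "0 < m" "\<And>j. m \<le> L $ j" and "0 \<le> t"
  shows "real (card (wlen \<Lambda> ` {v. wlen L v \<le> t})) \<le> (t / m + 1) ^ CARD('N)"
proof -
  define K where "K = nat \<lfloor>t / m\<rfloor>"
  define P where "P = (UNIV \<rightarrow>\<^sub>E {..K} :: ('N \<Rightarrow> nat) set)"
  have "word_count v $ i \<le> K" if "wlen L v \<le> t" for v i
  proof -
    have "real (word_count v $ i) * m \<le> L $ i * real (word_count v $ i)"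
      using m(2)[of i] by (simp add: mult.commute mult_right_mono)
    also have "\<dots> \<le> dot_nat L (word_count v)"
      using L unfolding dot_nat_def inner_vec_def
      by (intro order_trans[OF _ member_le_sum[of i]]) (auto simp: pos_delays_def less_imp_le)
    also have "\<dots> \<le> t" using that by simp
    finally have "real (word_count v $ i) \<le> t / m" using m by (simp add: field_simps)
    then show ?thesis unfolding K_def by linarith
  qed
  then have "wlen \<Lambda> ` {v. wlen L v \<le> t} \<subseteq> (\<lambda>f. dot_nat \<Lambda> (vec_lambda f)) ` P"
    by (auto simp: P_def PiE_UNIV_domain image_iff
        intro!: bexI[of _ "vec_nth (word_count v)" for v])
  moreover have "finite P" by (auto simp: P_def intro!: finite_PiE)
  ultimately have "card (wlen \<Lambda> ` {v. wlen L v \<le> t}) \<le> card P"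
    using surj_card_le by blast
  also have "card P = (K + 1) ^ CARD('N)" by (simp add: P_def card_PiE)
  finally have "real (card (wlen \<Lambda> ` {v. wlen L v \<le> t})) \<le> real ((K + 1) ^ CARD('N))"
    by (simp only: of_nat_le_iff)
  also have "\<dots> = (real K + 1) ^ CARD('N)" by (simp add: add.commute)
  also have "\<dots> \<le> (t / m + 1) ^ CARD('N)"
    using \<open>0 \<le> t\<close> m by (intro power_mono) (auto simp: K_def)
  finally show ?thesis .
qed

lemma power_le_exp:
  fixes \<epsilon> m :: real
  assumes "0 < \<epsilon>" "0 < m"
  obtains D where "0 < D" "\<And>t. 0 \<le> t \<Longrightarrow> (t / m + 1) ^ k \<le> D * exp (\<epsilon> * t)"
proof (cases "k = 0")
  case True
  then show ?thesis using assms that[of 1] by simp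
next
  case False
  \<comment> \<open>Chosen so that \<open>t / m + 1 \<le> D * (1 + \<epsilon> * t / k)\<close>,
    which is at most \<open>D * exp (\<epsilon> * t / k)\<close>; the \<open>k\<close>-th power then
    gives the claim.\<close>
  define D where "D = max 1 (k / (\<epsilon> * m))"
  show ?thesis
  proof (rule that)
    show "0 < D ^ k" by (simp add: D_def less_max_iff_disj)
    fix t :: real assume t: "0 \<le> t"
    have "1 / m \<le> D * (\<epsilon> / k)"
    proof -
      have "1 / m = (k / (\<epsilon> * m)) * (\<epsilon> / k)" using assms False by simp
      also have "\<dots> \<le> D * (\<epsilon> / k)" using assms by (intro mult_right_mono) (auto simp: D_def)
      finally show ?thesis .
    qed
    from mult_right_mono[OF this t] have "t / m + 1 \<le> D * (\<epsilon> * t / k) + D"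
      by (simp add: D_def algebra_simps)
    also have "\<dots> = D * (1 + \<epsilon> * t / k)" by (simp add: algebra_simps)
    also have "\<dots> \<le> D * exp (\<epsilon> * t / k)"
      by (intro mult_left_mono exp_ge_add_one_self) (simp add: D_def)
    finally have "(t / m + 1) ^ k \<le> (D * exp (\<epsilon> * t / k)) ^ k"
      using t assms by (intro power_mono) auto
    also have "\<dots> = D ^ k * exp (\<epsilon> * t)"
      using False by (simp add: power_mult_distrib flip: exp_of_nat_mult)
    finally show "(t / m + 1) ^ k \<le> D ^ k * exp (\<epsilon> * t)" .
  qed
qed

lemma sum_le_card_times_some:
  fixes f :: "'a \<Rightarrow> real"
  assumes "finite I" "I \<noteq> {}"
  shows "\<exists>i\<in>I. sum f I \<le> card I * f i"
proof -
  have "Max (f ` I) \<in> f ` I" using assms by (intro Max_in) auto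
  then obtain i where "i \<in> I" "Max (f ` I) = f i" by auto
  moreover have "sum f I \<le> card I * Max (f ` I)"
    using assms by (intro sum_bounded_above) auto
  ultimately show ?thesis by auto
qed

text \<open>Moving the time by at most \<open>l\<close> costs a constant factor, whatever the sign
  of \<open>a\<close>.\<close>

lemma exp_mult_le_exp_shift:
  fixes a x t l :: real
  assumes "\<bar>x - t\<bar> \<le> l"
  shows "exp (a * x) \<le> exp (\<bar>a\<bar> * l) * exp (a * t)"
proof -
  have "a * (x - t) \<le> \<bar>a\<bar> * l"
    using abs_ge_self[of "a * (x - t)"] assms mult_left_mono[of "\<bar>x - t\<bar>" l "\<bar>a\<bar>"]
    by (simp add: abs_mult)
  then show ?thesis by (simp add: algebra_simps flip: exp_add)
qed

text \<open>The sum over classes and letters is at most the number of its terms times the largest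
  one, so a single translate of the initial datum controls \<open>u (s + t)\<close>. The admissible
  shifts \<open>h\<close> form a finite set depending on \<open>t\<close> but not on
  \<open>s\<close> or \<open>u0\<close>, as required by \<open>Lp_norm_le_of_pointwise\<close>. The
  shift 0 serves the times \<open>s + t < 0\<close>.\<close>

lemma solution_pointwise_bound:
  fixes \<Lambda> L :: "real^'N" and \<BB> :: "((complex^'d^'d)^'N) set"
  assumes \<Lambda>: "\<Lambda> \<in> pos_delays" and L: "L \<in> V_plus \<Lambda>" and bdd: "bounded \<BB>" and C: "0 \<le> C"
    and bound: "\<And>v B. (\<And>r. B r \<in> \<BB>) \<Longrightarrow> norm (word_sum \<Lambda> B (wlen \<Lambda> v)) \<le> C * exp (a * wlen L v)"
  obtains D where "0 < D"
    "\<And>A u0 u t s. A \<in> L_infty \<BB> \<Longrightarrow> is_solution L A u0 u \<Longrightarrow> 0 \<le> t \<Longrightarrow> s \<in> {- L_max L..<0} \<Longrightarrow>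
      \<exists>h\<in>insert 0 ((\<lambda>(x, j). class_len \<Lambda> L x + L $ j) ` (wlen \<Lambda> ` {v. wlen L v \<le> t} \<times> UNIV)).
        norm (u (s + t)) \<le> D * (real (card (wlen \<Lambda> ` {v. wlen L v \<le> t})) + 1) * exp (a * t) *
          norm (zero_ext L u0 (s + t - h))"
proof -
  have L': "L \<in> pos_delays" using L by (simp add: V_plus_def)
  obtain R where R: "0 < R" "\<And>b. b \<in> \<BB> \<Longrightarrow> norm b \<le> R"
    using bdd unfolding bounded_pos by blast
  obtain \<kappa> where \<kappa>: "0 < \<kappa>" "\<And>(M::complex^'d^'d) w. norm (M *v w) \<le> norm M * norm w * \<kappa>"
    using bounded_bilinear.pos_bounded[OF bounded_bilinear_matrix_vector_mult] by blast
  \<comment> \<open>The price for replacing a time within \<open>2 * L_max L\<close> of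
    \<open>t\<close> by \<open>t\<close> in the exponential.\<close>
  define E where "E = exp (\<bar>a\<bar> * (2 * L_max L))"
  have E: "1 \<le> E" using L_max_pos[OF L'] by (simp add: E_def)
  \<comment> \<open>The summand 1 serves negative \<open>s + t\<close>; the other collects the
    constants of the sum over words, with \<open>CARD('N)\<close> from the sum over the last
    delay.\<close>
  define D where "D = (1 + \<kappa> * \<kappa> * R * C * CARD('N)) * E"
  have D0: "0 \<le> \<kappa> * \<kappa> * R * C * CARD('N)" using \<kappa> R C by simp
  then have D: "E \<le> D" "\<kappa> * \<kappa> * R * C * CARD('N) * E \<le> D"
    using E mult_nonneg_nonneg[OF D0, of E] by (simp_all add: D_def algebra_simps)
  show ?thesis
  proof (rule that)
    show "0 < D" using D E by linarith
    fix A :: "real \<Rightarrow> (complex^'d^'d)^'N" and u0 u and t s :: real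
    assume A: "A \<in> L_infty \<BB>" and u: "is_solution L A u0 u" and t: "0 \<le> t" and s: "s \<in> {- L_max L..<0}"
    define X where "X t = wlen \<Lambda> ` {v. wlen L v \<le> t}" for t
    have finX: "finite (X t)" for t unfolding X_def using finite_wlen_le[OF L'] by simp
    define \<tau> where "\<tau> = s + t"
    show "\<exists>h\<in>insert 0 ((\<lambda>(x, j). class_len \<Lambda> L x + L $ j) ` (wlen \<Lambda> ` {v. wlen L v \<le> t} \<times> UNIV)).
        norm (u (s + t)) \<le> D * (real (card (wlen \<Lambda> ` {v. wlen L v \<le> t})) + 1) * exp (a * t) *
          norm (zero_ext L u0 (s + t - h))"
      unfolding X_def[symmetric] \<tau>_def[symmetric]
    proof (cases "\<tau> < 0")
      case True
      have "exp (a * 0) \<le> E * exp (a * t)"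
        unfolding E_def using True s t by (intro exp_mult_le_exp_shift) (auto simp: \<tau>_def)
      also have "\<dots> \<le> D * exp (a * t)" using D by simp
      also have "\<dots> \<le> D * (real (card (X t)) + 1) * exp (a * t)"
        using \<open>0 < D\<close> by (simp add: algebra_simps)
      finally have "1 \<le> D * (real (card (X t)) + 1) * exp (a * t)" by simp
      moreover have "u \<tau> = zero_ext L u0 (\<tau> - 0)"
        using True s t u by (auto simp: \<tau>_def is_solution_def zero_ext_def)
      ultimately have "norm (u \<tau>) \<le> D * (real (card (X t)) + 1) * exp (a * t) * norm (zero_ext L u0 (\<tau> - 0))"
        using mult_right_mono[of 1 _ "norm (u \<tau>)"] by simp
      then show "\<exists>h\<in>insert 0 ((\<lambda>(x, j). class_len \<Lambda> L x + L $ j) ` (X t \<times> UNIV)).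
          norm (u \<tau>) \<le> D * (real (card (X t)) + 1) * exp (a * t) * norm (zero_ext L u0 (\<tau> - h))" by blast
    next
      case False
      define z where "z x j = zero_ext L u0 (\<tau> - class_len \<Lambda> L x - L $ j)" for x j
      define Q where "Q = \<kappa> * \<kappa> * R * C * E * exp (a * t)"
      have Q: "0 \<le> Q" using \<kappa> R C E by (simp add: Q_def)
      have term_le: "norm (word_sum \<Lambda> (\<lambda>r. A (\<tau> - class_len \<Lambda> L r)) x *v (\<Sum>j\<in>UNIV. A (\<tau> - class_len \<Lambda> L x) $ j *v z x j))
          \<le> (\<Sum>j\<in>UNIV. Q * norm (z x j))" if x: "x \<in> X \<tau>" for x
      proof -
        obtain v where v: "x = wlen \<Lambda> v" using x by (auto simp: X_def)
        define M where "M = word_sum \<Lambda> (\<lambda>r. A (\<tau> - class_len \<Lambda> L r)) x"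
        have M: "norm M \<le> C * exp (a * class_len \<Lambda> L x)"
          unfolding M_def v class_len_wlen[OF L] using A by (intro bound) (auto simp: L_infty_def)
        have "norm (M *v (A (\<tau> - class_len \<Lambda> L x) $ j *v z x j)) \<le> Q * norm (z x j)" for j
        proof (cases "z x j = 0")
          case True
          then show ?thesis by simp
        next
          case False
          \<comment> \<open>A nonzero \<open>z x j\<close> reads the initial datum inside
            \<open>[-L_max, 0)\<close>, which pins the length of the class near
            \<open>t\<close>.\<close>
          then have "- L_max L \<le> \<tau> - class_len \<Lambda> L x - L $ j" "\<tau> - class_len \<Lambda> L x - L $ j < 0"
            by (auto simp: z_def zero_ext_def split: if_splits)
          moreover have "0 < L $ j" using L' by (simp add: pos_delays_def)
          ultimately have "\<bar>class_len \<Lambda> L x - t\<bar> \<le> 2 * L_max L"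
            using s le_L_max[of L j] by (auto simp: \<tau>_def abs_le_iff)
          then have "exp (a * class_len \<Lambda> L x) \<le> E * exp (a * t)"
            unfolding E_def by (rule exp_mult_le_exp_shift)
          with M C have M': "norm M \<le> C * (E * exp (a * t))"
            by (meson mult_left_mono order_trans)
          have "norm (A (\<tau> - class_len \<Lambda> L x) $ j) \<le> R"
            using A R(2) Finite_Cartesian_Product.norm_nth_le order_trans by (fastforce simp: L_infty_def)
          then have "norm (A (\<tau> - class_len \<Lambda> L x) $ j *v z x j) \<le> R * norm (z x j) * \<kappa>"
            using \<kappa> by (meson mult_right_mono norm_ge_zero order_trans less_imp_le)
          then have "norm M * norm (A (\<tau> - class_len \<Lambda> L x) $ j *v z x j) * \<kappa>
              \<le> C * (E * exp (a * t)) * (R * norm (z x j) * \<kappa>) * \<kappa>"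
            using M' \<kappa> C E by (intro mult_right_mono mult_mono) auto
          then show ?thesis
            using \<kappa>(2)[of M "A (\<tau> - class_len \<Lambda> L x) $ j *v z x j"] by (simp add: Q_def mult_ac)
        qed
        then show ?thesis
          unfolding M_def[symmetric] matrix_vector_mult_sum_right
          by (intro order_trans[OF norm_sum] sum_mono) auto
      qed
      have "u \<tau> = (\<Sum>x\<in>X \<tau>. word_sum \<Lambda> (\<lambda>r. A (\<tau> - class_len \<Lambda> L r)) x *v (\<Sum>j\<in>UNIV. A (\<tau> - class_len \<Lambda> L x) $ j *v z x j))"
        unfolding X_def z_def using solution_class_representation[OF \<Lambda> L u] False by simp
      then have "norm (u \<tau>) \<le> (\<Sum>x\<in>X \<tau>. \<Sum>j\<in>UNIV. Q * norm (z x j))"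
        using term_le by (simp add: sum_norm_le)
      also have "\<dots> = (\<Sum>(x, j)\<in>X \<tau> \<times> UNIV. Q * norm (z x j))"
        by (rule sum.cartesian_product)
      finally have le: "norm (u \<tau>) \<le> \<dots>" .
      have "[] \<in> {v. wlen L v \<le> \<tau>}" using False by simp
      then have "X \<tau> \<noteq> {}" unfolding X_def by blast
      then obtain x j where xj: "x \<in> X \<tau>"
        "(\<Sum>(x, j)\<in>X \<tau> \<times> UNIV. Q * norm (z x j)) \<le> card (X \<tau> \<times> (UNIV :: 'N set)) * (Q * norm (z x j))"
        using sum_le_card_times_some[of "X \<tau> \<times> (UNIV :: 'N set)" "\<lambda>(x, j). Q * norm (z x j)"] finX by auto
      \<comment> \<open>Enlarging the set of classes makes both the count and the set of shifts
        independent of \<open>s\<close>.\<close>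
      have sub: "X \<tau> \<subseteq> X t" using s by (auto simp: X_def \<tau>_def)
      have "card (X \<tau> \<times> (UNIV :: 'N set)) * (Q * norm (z x j)) = real (card (X \<tau>)) * (CARD('N) * Q) * norm (z x j)"
        by (simp add: card_cartesian_product)
      also have "\<dots> \<le> (real (card (X t)) + 1) * (CARD('N) * Q) * norm (z x j)"
        using card_mono[OF finX sub] Q by (intro mult_right_mono) auto
      also have "\<dots> \<le> (real (card (X t)) + 1) * (D * exp (a * t)) * norm (z x j)"
        using mult_right_mono[OF D(2), of "exp (a * t)"] by (intro mult_right_mono mult_left_mono) (auto simp: Q_def mult_ac)
      finally have "norm (u \<tau>) \<le> D * (real (card (X t)) + 1) * exp (a * t) * norm (zero_ext L u0 (\<tau> - (class_len \<Lambda> L x + L $ j)))"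
        using le xj by (simp add: z_def algebra_simps)
      then show "\<exists>h\<in>insert 0 ((\<lambda>(x, j). class_len \<Lambda> L x + L $ j) ` (X t \<times> UNIV)).
          norm (u \<tau>) \<le> D * (real (card (X t)) + 1) * exp (a * t) * norm (zero_ext L u0 (\<tau> - h))"
        using xj(1) sub by (intro bexI[of _ "class_len \<Lambda> L x + L $ j"]) auto
    qed
  qed
qed

text \<open>The pointwise bound is integrated over finitely many translates of the initial datum.
  All counting factors are polynomial in \<open>t\<close>, and the gap \<open>b - a\<close> absorbs
  them.\<close>

lemma state_norm_growth_bound:
  fixes \<Lambda> L :: "real^'N" and \<BB> :: "((complex^'d^'d)^'N) set"
  assumes \<Lambda>: "\<Lambda> \<in> pos_delays" and L: "L \<in> V_plus \<Lambda>" and bdd: "bounded \<BB>" and C: "0 \<le> C"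
    and bound: "\<And>v B. (\<And>r. B r \<in> \<BB>) \<Longrightarrow> norm (word_sum \<Lambda> B (wlen \<Lambda> v)) \<le> C * exp (a * wlen L v)"
    and "a < b" and p: "1 \<le> p"
  obtains K where "0 < K"
    "\<And>A u0 u t. A \<in> L_infty \<BB> \<Longrightarrow> u0 \<in> X_space L p \<Longrightarrow> is_solution L A u0 u \<Longrightarrow> 0 \<le> t \<Longrightarrow>
      state_norm L p (shifted u t) \<le> ennreal (K * exp (b * t)) * state_norm L p u0"
proof -
  have L': "L \<in> pos_delays" using L by (simp add: V_plus_def)
  obtain m where m: "0 < m" "\<And>j. m \<le> L $ j"
    using pos_delays_lower_bound[OF L'] by blast
  obtain D where D: "0 < D"
    "\<And>A u0 u t s. A \<in> L_infty \<BB> \<Longrightarrow> is_solution L A u0 u \<Longrightarrow> 0 \<le> t \<Longrightarrow> s \<in> {- L_max L..<0} \<Longrightarrow>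
      \<exists>h\<in>insert 0 ((\<lambda>(x, j). class_len \<Lambda> L x + L $ j) ` (wlen \<Lambda> ` {v. wlen L v \<le> t} \<times> UNIV)).
        norm (u (s + t)) \<le> D * (real (card (wlen \<Lambda> ` {v. wlen L v \<le> t})) + 1) * exp (a * t) *
          norm (zero_ext L u0 (s + t - h))"
    using solution_pointwise_bound[OF \<Lambda> L bdd C bound] by blast
  \<comment> \<open>The degree is twice \<open>CARD('N)\<close>: the number of classes enters once
    through the pointwise bound and once through the number \<open>card H\<close> of
    translates.\<close>
  obtain D' where D': "0 < D'" "\<And>t. 0 \<le> t \<Longrightarrow> (t / m + 1) ^ (CARD('N) + CARD('N)) \<le> D' * exp ((b - a) * t)"
    using power_le_exp[of "b - a" m] \<open>a < b\<close> m(1) by (metis diff_gt_0_iff_gt)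
  define N where "N = real CARD('N)"
  have N: "1 \<le> N" unfolding N_def by (simp add: Suc_le_eq)
  define K where "K = 4 * D * N * D'"
  show ?thesis
  proof (rule that)
    show "0 < K" using D D' N by (simp add: K_def)
    fix A :: "real \<Rightarrow> (complex^'d^'d)^'N" and u0 u and t :: real
    assume A: "A \<in> L_infty \<BB>" and u0: "u0 \<in> X_space L p" and u: "is_solution L A u0 u" and t: "0 \<le> t"
    define S where "S = {- L_max L..<0}"
    have S: "S \<in> sets lebesgue" by (simp add: S_def)
    have u0m: "u0 \<in> borel_measurable (lebesgue_on S)" and fin: "state_norm L p u0 < \<infinity>"
      using u0 by (auto simp: X_space_def S_def)
    define X where "X = wlen \<Lambda> ` {v. wlen L v \<le> t}"
    define H where "H = insert 0 ((\<lambda>(x, j). class_len \<Lambda> L x + L $ j) ` (X \<times> (UNIV :: 'N set)))"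
    have finX: "finite X" unfolding X_def using finite_wlen_le[OF L'] by simp
    then have H: "finite H" "H \<noteq> {}" by (auto simp: H_def)
    define c where "c = D * (real (card X) + 1) * exp (a * t)"
    have c: "0 \<le> c" using D by (simp add: c_def)
    have zero_ext_eq: "zero_ext L u0 = (\<lambda>s. if s \<in> S then u0 s else 0)"
      by (auto simp: zero_ext_def S_def)
    have zm: "zero_ext L u0 \<in> borel_measurable lebesgue"
      unfolding zero_ext_eq using u0m S by (rule borel_measurable_if_I)
    have "Lp_norm p (lebesgue_on S) (shifted u t) \<le> ennreal (c * card H) * state_norm L p u0"
    proof (rule Lp_norm_le_of_pointwise[where g = "\<lambda>h s. zero_ext L u0 (s + (t - h))", OF p H c _ _ _ _ fin])
      show "shifted u t \<in> borel_measurable (lebesgue_on S)"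
        unfolding S_def using solution_measurable[OF L' u _ _ t] A u0m by (simp add: S_def L_infty_def)
      show "(\<lambda>s. zero_ext L u0 (s + (t - h))) \<in> borel_measurable (lebesgue_on S)" for h
        by (intro measurable_restrict_space1 borel_measurable_lebesgue_translation[OF zm])
      show "\<exists>h\<in>H. norm (shifted u t s) \<le> c * norm (zero_ext L u0 (s + (t - h)))"
        if "s \<in> space (lebesgue_on S)" for s
        using D(2)[OF A u t, of s] that by (simp add: shifted_def H_def c_def X_def S_def algebra_simps)
      show "Lp_norm p (lebesgue_on S) (\<lambda>s. zero_ext L u0 (s + (t - h))) \<le> state_norm L p u0" for h
        using Lp_norm_translation_le[OF p S u0m, of "t - h"] by (simp add: zero_ext_eq state_norm_def S_def)
    qed
    also have "\<dots> \<le> ennreal (K * exp (b * t)) * state_norm L p u0"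
    proof (intro mult_right_mono ennreal_leI)
      define y where "y = (t / m + 1) ^ CARD('N)"
      have y: "1 \<le> y" unfolding y_def using t m(1) by (intro one_le_power) simp
      have X: "real (card X) + 1 \<le> 2 * y"
        using card_length_classes_le[OF L' m t, of \<Lambda>] y by (simp add: X_def y_def)
      have "card H \<le> Suc (card (X \<times> (UNIV :: 'N set)))"
        unfolding H_def using finX
        by (intro card_insert_le_m1, simp, simp only: diff_Suc_1) (rule card_image_le, simp)
      then have "real (card H) \<le> 1 + N * card X"
        by (simp add: N_def card_cartesian_product mult.commute flip: of_nat_mult)
      also have "\<dots> \<le> N * (real (card X) + 1)" using N by (simp add: algebra_simps)
      finally have "real (card H) \<le> N * (2 * y)"
        using X N by (meson mult_left_mono order_trans zero_le_one)
      then have "c * card H \<le> (D * (2 * y) * exp (a * t)) * (N * (2 * y))"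
        unfolding c_def using X D y N by (intro mult_mono) auto
      also have "\<dots> = 4 * D * N * (t / m + 1) ^ (CARD('N) + CARD('N)) * exp (a * t)"
        by (simp add: y_def power_add)
      also have "\<dots> \<le> 4 * D * N * (D' * exp ((b - a) * t)) * exp (a * t)"
        using D N D'(2)[OF t] by (intro mult_right_mono mult_left_mono) auto
      also have "\<dots> = K * exp (b * t)"
        by (simp add: K_def algebra_simps flip: exp_add)
      finally show "c * card H \<le> K * exp (b * t)" .
    qed auto
    finally show "state_norm L p (shifted u t) \<le> ennreal (K * exp (b * t)) * state_norm L p u0"
      by (simp add: state_norm_def S_def)
  qed
qed

section \<open>Impulse responses\<close>

text \<open>For \<open>t\<close> in the window before \<open>x\<close>, a word reaches the impulse
  only if its length is within \<eta> of \<open>x\<close>, and \<open>sep\<close> then forces length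
  exactly \<open>x\<close>. Along such a word the coefficient is read at \<open>t - r\<close>,
  inside the window where \<open>A\<close> equals \<open>B r\<close>.\<close>

lemma impulse_response:
  fixes \<Lambda> :: "real^'N" and B :: "real \<Rightarrow> (complex^'d^'d)^'N"
  assumes \<Lambda>: "\<Lambda> \<in> pos_delays" and x: "x \<in> \<L>_set \<Lambda>" "0 < x"
    and \<eta>: "0 < \<eta>" "\<eta> \<le> 1" "\<eta> \<le> L_max \<Lambda>"
    and sep: "\<And>v w. wlen \<Lambda> v \<le> x + 1 \<Longrightarrow> wlen \<Lambda> w \<le> x + 1 \<Longrightarrow> wlen \<Lambda> v \<noteq> wlen \<Lambda> w \<Longrightarrow>
               \<eta> \<le> \<bar>wlen \<Lambda> v - wlen \<Lambda> w\<bar>"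
    and A: "\<And>r s. r \<in> \<L>_below \<Lambda> x \<Longrightarrow> s \<in> {x - r - \<eta>..<x - r} \<Longrightarrow> A s = B r"
    and u: "is_solution \<Lambda> A (\<lambda>s. if s \<in> {- \<eta>..<0} then w else 0) u"
    and t: "t \<in> {x - \<eta>..<x}"
  shows "u t = word_sum \<Lambda> B x *v w"
proof -
  obtain v0 where v0: "x = wlen \<Lambda> v0" using x(1) by (auto simp: \<L>_set_eq)
  \<comment> \<open>Comparison with the empty word, which has length 0.\<close>
  have "\<eta> \<le> x" using sep[of v0 "[]"] x(2) by (simp add: v0)
  then have t0: "0 \<le> t" using t by simp
  define z where "z = zero_ext \<Lambda> (\<lambda>s. if s \<in> {- \<eta>..<0} then w else 0)"
  have z: "z s = (if s \<in> {- \<eta>..<0} then w else 0)" for s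
    using \<eta> by (auto simp: z_def zero_ext_def)
  define P where "P = path_prod \<Lambda> (\<lambda>r. A (t - r)) 0"
  define f where "f q = P q *v z (t - wlen \<Lambda> q)" for q
  define E where "E = {v. wlen \<Lambda> v \<le> t}"
  \<comment> \<open>The representation treats the last delay, the one that reaches the initial
    datum, separately from \<open>v\<close>; appending it as a last letter yields whole
    words.\<close>
  define Q where "Q = (\<lambda>(v, j). v @ [j]) ` (E \<times> UNIV)"
  define W where "W = {q. wlen \<Lambda> q = x}"
  have finE: "finite E" unfolding E_def by (rule finite_wlen_le[OF \<Lambda>])
  have "u t = (\<Sum>v\<in>E. \<Sum>j\<in>UNIV. f (v @ [j]))"
  proof -
    have "P v *v (\<Sum>j\<in>UNIV. A (t - wlen \<Lambda> v) $ j *v z (t - wlen \<Lambda> v - \<Lambda> $ j)) = (\<Sum>j\<in>UNIV. f (v @ [j]))" for v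
      unfolding matrix_vector_mult_sum_right f_def P_def
      by (intro sum.cong refl) (simp add: path_prod_append matrix_vector_mul_assoc algebra_simps)
    then show ?thesis
      using solution_representation[OF \<Lambda> u, of t] t0 by (simp add: E_def P_def z_def)
  qed
  also have "\<dots> = (\<Sum>(v, j)\<in>E \<times> UNIV. f (v @ [j]))"
    by (rule sum.cartesian_product)
  also have "\<dots> = sum f Q"
    unfolding Q_def by (subst sum.reindex) (auto simp: inj_on_def case_prod_unfold)
  also have "\<dots> = sum f W"
  proof (rule sum.mono_neutral_right)
    show "finite Q" unfolding Q_def using finE by simp
    show "W \<subseteq> Q"
    proof
      fix q assume q: "q \<in> W"
      then have "q \<noteq> []" using x(2) by (auto simp: W_def)
      then obtain v j where vj: "q = v @ [j]" by (metis rev_exhaust)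
      have "0 < \<Lambda> $ j" using \<Lambda> by (simp add: pos_delays_def)
      then have "wlen \<Lambda> v < x" using q by (auto simp: W_def vj)
      \<comment> \<open>Separation turns the strict inequality into a gap of \<eta>, which places
        \<open>v\<close> below every \<open>t\<close> of the window.\<close>
      then have "wlen \<Lambda> v \<le> x - \<eta>" using sep[of v v0] by (simp add: v0)
      then have "v \<in> E" using t by (simp add: E_def)
      then show "q \<in> Q" by (auto simp: Q_def vj)
    qed
    show "\<forall>q\<in>Q - W. f q = 0"
    proof
      fix q assume q: "q \<in> Q - W"
      have "t - wlen \<Lambda> q \<notin> {- \<eta>..<0}"
      proof
        assume "t - wlen \<Lambda> q \<in> {- \<eta>..<0}"
        then have "\<bar>wlen \<Lambda> q - wlen \<Lambda> v0\<bar> < \<eta>" using t by (auto simp flip: v0)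
        \<comment> \<open>Because \<eta> is at most 1, the length stays in the range where
          \<open>sep\<close> applies.\<close>
        moreover have "wlen \<Lambda> q \<le> x + 1" "wlen \<Lambda> q \<noteq> wlen \<Lambda> v0"
          using calculation q \<eta> by (auto simp: W_def simp flip: v0)
        ultimately show False using sep[of q v0] by (simp add: v0)
      qed
      then show "f q = 0" by (auto simp: f_def z)
    qed
  qed
  also have "\<dots> = (\<Sum>q\<in>W. path_prod \<Lambda> B 0 q *v w)"
  proof (rule sum.cong[OF refl])
    fix q assume q: "q \<in> W"
    have "path_prod \<Lambda> (\<lambda>r. A (t - r)) (wlen \<Lambda> []) q = path_prod \<Lambda> B (wlen \<Lambda> []) q"
      using A t q by (intro path_prod_cong[OF \<Lambda>, of x]) (auto simp: W_def)
    then show "f q = path_prod \<Lambda> B 0 q *v w"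
      using q t by (simp add: f_def P_def z W_def)
  qed
  also have "\<dots> = word_sum \<Lambda> B x *v w"
    by (simp add: W_def word_sum_eq[OF \<Lambda>] matrix_vector_mult_sum_left)
  finally show ?thesis .
qed

lemma finite_set_separated:
  fixes F :: "real set"
  assumes "finite F"
  obtains \<eta> where "0 < \<eta>" "\<And>r r'. r \<in> F \<Longrightarrow> r' \<in> F \<Longrightarrow> r \<noteq> r' \<Longrightarrow> \<eta> \<le> \<bar>r - r'\<bar>"
proof -
  \<comment> \<open>The element 1 keeps \<open>D\<close> nonempty when \<open>F\<close> has at most
    one point.\<close>
  define D where "D = insert 1 ((\<lambda>(r, r'). \<bar>r - r'\<bar>) ` (F \<times> F - Id))"
  have fin: "finite D" using assms by (simp add: D_def)
  show ?thesis
  proof (rule that)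
    show "0 < Min D" using fin by (subst Min_gr_iff) (auto simp: D_def)
    fix r r' assume "r \<in> F" "r' \<in> F" "r \<noteq> r'"
    then have "\<bar>r - r'\<bar> \<in> D" by (auto simp: D_def)
    then show "Min D \<le> \<bar>r - r'\<bar>" using fin by simp
  qed
qed

text \<open>An admissible coefficient and an impulse of norm 1 are built whose solution displays the
  columns of the word sum, up to the normalisation of the impulse; the assumed bound on solutions
  then bounds the matrix column by column.\<close>

lemma word_sum_le_of_solution_bound:
  fixes \<Lambda> :: "real^'N" and \<BB> :: "((complex^'d^'d)^'N) set"
  assumes \<Lambda>: "\<Lambda> \<in> pos_delays" and p: "1 \<le> p" and x: "x \<in> \<L>_set \<Lambda>" "0 < x"
    and B: "B \<in> Pi (\<L>_below \<Lambda> x) (\<lambda>_. \<BB>)" and ne: "\<BB> \<noteq> {}" and G: "0 \<le> G"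
    and bound: "\<And>A u0 u. A \<in> L_infty \<BB> \<Longrightarrow> u0 \<in> X_space \<Lambda> p \<Longrightarrow> state_norm \<Lambda> p u0 = 1 \<Longrightarrow>
      is_solution \<Lambda> A u0 u \<Longrightarrow> state_norm \<Lambda> p (shifted u x) \<le> ennreal G"
  shows "norm (word_sum \<Lambda> B x) \<le> real CARD('d) * real CARD('d) * G"
proof (rule norm_le_of_mult_vec_le)
  fix i :: 'd
  obtain b0 where b0: "b0 \<in> \<BB>" using ne by blast
  have finF: "finite (wlen \<Lambda> ` {v. wlen \<Lambda> v \<le> x + 1})"
    using finite_wlen_le[OF \<Lambda>] by simp
  obtain \<eta>0 where \<eta>0: "0 < \<eta>0"
    "\<And>r r'. r \<in> wlen \<Lambda> ` {v. wlen \<Lambda> v \<le> x + 1} \<Longrightarrow> r' \<in> wlen \<Lambda> ` {v. wlen \<Lambda> v \<le> x + 1} \<Longrightarrow>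
      r \<noteq> r' \<Longrightarrow> \<eta>0 \<le> \<bar>r - r'\<bar>"
    using finite_set_separated[OF finF] by blast
  define \<eta> where "\<eta> = min \<eta>0 (min 1 (L_max \<Lambda>))"
  have \<eta>: "0 < \<eta>" "\<eta> \<le> 1" "\<eta> \<le> L_max \<Lambda>"
    using \<eta>0 L_max_pos[OF \<Lambda>] by (auto simp: \<eta>_def)
  have sep: "\<eta> \<le> \<bar>wlen \<Lambda> v - wlen \<Lambda> w\<bar>"
    if "wlen \<Lambda> v \<le> x + 1" "wlen \<Lambda> w \<le> x + 1" "wlen \<Lambda> v \<noteq> wlen \<Lambda> w" for v w
    using \<eta>0(2)[of "wlen \<Lambda> v" "wlen \<Lambda> w"] that by (auto simp: \<eta>_def)
  define R where "R = \<L>_below \<Lambda> x"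
  have finR: "finite R"
    unfolding R_def \<L>_below_def \<L>_set_eq by (rule finite_subset[OF _ finF]) auto
  \<comment> \<open>A step function equal to \<open>B r\<close> on the window belonging to
    \<open>r\<close> and to \<open>b0\<close> elsewhere. The windows are disjoint by separation, so
    at most one summand is nonzero and all values lie in \<open>\<BB>\<close>.\<close>
  define A where "A s = b0 + (\<Sum>r\<in>R. if s \<in> {x - r - \<eta>..<x - r} then B r - b0 else 0)" for s
  have A_eq: "A s = B r" if r: "r \<in> R" "s \<in> {x - r - \<eta>..<x - r}" for r s
  proof -
    have "s \<notin> {x - r' - \<eta>..<x - r'}" if r': "r' \<in> R" "r' \<noteq> r" for r'
    proof
      assume "s \<in> {x - r' - \<eta>..<x - r'}"
      then have "\<bar>r - r'\<bar> < \<eta>" using r by (auto simp: abs_less_iff)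
      moreover obtain v v' where "r = wlen \<Lambda> v" "r' = wlen \<Lambda> v'" "r < x" "r' < x"
        using r r' by (auto simp: R_def \<L>_below_def \<L>_set_eq)
      ultimately show False using sep[of v v'] r' by simp
    qed
    then have "(\<Sum>r'\<in>R. if s \<in> {x - r' - \<eta>..<x - r'} then B r' - b0 else 0) = (\<Sum>r'\<in>R. if r = r' then B r' - b0 else 0)"
      using r by (intro sum.cong) (auto simp del: atLeastLessThan_iff)
    then show ?thesis using finR r by (simp add: A_def)
  qed
  have A_mem: "A s \<in> \<BB>" for s
  proof (cases "\<exists>r\<in>R. s \<in> {x - r - \<eta>..<x - r}")
    case True
    then obtain r where "r \<in> R" "A s = B r" using A_eq by blast
    then show ?thesis using B by (auto simp: R_def)
  next
    case False
    then have "A s = b0" by (simp add: A_def del: atLeastLessThan_iff)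
    then show ?thesis using b0 by simp
  qed
  have A: "A \<in> L_infty \<BB>"
  proof -
    have "A \<in> borel_measurable lebesgue"
      unfolding A_def by (intro borel_measurable_add borel_measurable_sum measurable_If_set) auto
    then show ?thesis using A_mem by (simp add: L_infty_def)
  qed
  define S where "S = {- L_max \<Lambda>..<0}"
  have S: "S \<in> sets lebesgue" "{- \<eta>..<- \<eta> + \<eta>} \<subseteq> S" using \<eta> by (auto simp: S_def)
  obtain \<kappa> where \<kappa>: "0 < \<kappa>" "\<And>w :: complex^'d.
      Lp_norm p (lebesgue_on S) (\<lambda>s. if s \<in> {- \<eta>..<- \<eta> + \<eta>} then w else 0) = ennreal (norm w * \<kappa>)"
    using Lp_norm_impulse[OF p S \<eta>(1)] by blast
  \<comment> \<open>Normalised so that the impulse has norm 1.\<close>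
  define w :: "complex^'d" where "w = (1 / \<kappa>) *\<^sub>R axis i 1"
  define u0 where "u0 w s = (if s \<in> {- \<eta>..<0} then w else 0)" for w :: "complex^'d" and s
  have meas: "u0 w \<in> borel_measurable (lebesgue_on S)" for w
    unfolding u0_def by (intro measurable_restrict_space1 measurable_If_set) auto
  have norm_u0: "Lp_norm p (lebesgue_on S) (u0 w) = ennreal (norm w * \<kappa>)" for w
    using \<kappa>(2)[of w] by (simp add: u0_def[abs_def])
  have "state_norm \<Lambda> p (u0 w) = 1"
    using norm_u0[of w] \<kappa>(1) by (simp add: state_norm_def S_def w_def)
  moreover have "u0 w \<in> X_space \<Lambda> p"
    using calculation meas[of w] by (simp add: X_space_def S_def)
  moreover obtain u where u: "is_solution \<Lambda> A (u0 w) u"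
    using is_solution_exists[OF \<Lambda>] by blast
  ultimately have le: "state_norm \<Lambda> p (shifted u x) \<le> ennreal G"
    using bound[OF A] by blast
  have u_eq: "u t = word_sum \<Lambda> B x *v w" if "t \<in> {x - \<eta>..<x}" for t
    using u A_eq by (intro impulse_response[OF \<Lambda> x \<eta> sep _ _ that]) (auto simp: u0_def[abs_def] R_def)
  \<comment> \<open>The impulse of height \<open>word_sum \<Lambda> B x *v w\<close> agrees with the
    shifted solution on \<open>[-\<eta>, 0)\<close> and vanishes elsewhere, so it is dominated
    pointwise by that single function.\<close>
  have "Lp_norm p (lebesgue_on S) (u0 (word_sum \<Lambda> B x *v w)) \<le> ennreal (1 * real (card {()})) * ennreal G"
  proof (rule Lp_norm_le_of_pointwise[where g = "\<lambda>_. shifted u x" and I = "{()}", OF p])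
    show "shifted u x \<in> borel_measurable (lebesgue_on S)"
      unfolding S_def using solution_measurable[OF \<Lambda> u] A meas[of w] x(2) by (simp add: S_def L_infty_def)
    show "Lp_norm p (lebesgue_on S) (shifted u x) \<le> ennreal G"
      using le by (simp add: state_norm_def S_def)
    fix s
    have "norm (u0 (word_sum \<Lambda> B x *v w) s) \<le> norm (shifted u x s)"
      using u_eq[of "s + x"] by (simp add: u0_def shifted_def)
    then show "\<exists>i\<in>{()}. norm (u0 (word_sum \<Lambda> B x *v w) s) \<le> 1 * norm (shifted u x s)" by simp
  qed (auto intro: meas)
  then have "norm (word_sum \<Lambda> B x *v w) * \<kappa> \<le> G"
    using G by (simp add: norm_u0)
  moreover have "word_sum \<Lambda> B x *v w = (1 / \<kappa>) *\<^sub>R (word_sum \<Lambda> B x *v axis i 1)"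
    unfolding w_def by (rule bounded_bilinear.scaleR_right[OF bounded_bilinear_matrix_vector_mult])
  ultimately show "norm (word_sum \<Lambda> B x *v axis i 1) \<le> G"
    using \<kappa>(1) by simp
qed

section \<open>The quantity \<open>\<mu>\<close>\<close>

text \<open>The upper bound comes from expansion in the basis and makes \<open>nrm\<close>
  Lipschitz. By compactness \<open>nrm\<close> attains a positive minimum on the unit sphere, and
  homogeneity gives the lower bound.\<close>

lemma matrix_norm_equivalent:
  fixes nrm :: "complex^'d^'d \<Rightarrow> real"
  assumes "is_matrix_norm nrm"
  obtains c1 c2 where "0 < c1" "0 < c2" "\<And>M. nrm M \<le> c1 * norm M" "\<And>M. norm M \<le> c2 * nrm M"
proof -
  have pos: "0 \<le> nrm M" and zero: "nrm M = 0 \<longleftrightarrow> M = 0"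
    and tri: "nrm (M + M') \<le> nrm M + nrm M'"
    and hom: "nrm (\<chi> i j. c * M $ i $ j) = cmod c * nrm M" for M M' c
    using assms by (auto simp: is_matrix_norm_def)
  have scale: "nrm (r *\<^sub>R M) = \<bar>r\<bar> * nrm M" for r M
  proof -
    have "r *\<^sub>R M = (\<chi> i j. complex_of_real r * M $ i $ j)"
      by (simp add: vec_eq_iff complex_eq_iff)
    then show ?thesis using hom[of "complex_of_real r" M] by simp
  qed
  have sum_le: "nrm (\<Sum>b\<in>F. f b) \<le> (\<Sum>b\<in>F. nrm (f b))" for F and f :: "complex^'d^'d \<Rightarrow> complex^'d^'d"
  proof (induction F rule: infinite_finite_induct)
    case (insert b F)
    then show ?case using order_trans[OF tri add_left_mono] by simp
  qed (use zero[of 0] in auto)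
  define c1 where "c1 = 1 + (\<Sum>b\<in>Basis. nrm b)"
  have c1: "0 < c1" unfolding c1_def using pos by (simp add: add_pos_nonneg sum_nonneg)
  have upper: "nrm M \<le> c1 * norm M" for M
  proof -
    have "nrm M = nrm (\<Sum>b\<in>Basis. (M \<bullet> b) *\<^sub>R b)" by (simp add: euclidean_representation)
    also have "\<dots> \<le> (\<Sum>b\<in>Basis. \<bar>M \<bullet> b\<bar> * nrm b)" using sum_le by (simp flip: scale)
    also have "\<dots> \<le> (\<Sum>b\<in>Basis. norm M * nrm b)"
      using pos by (intro sum_mono mult_right_mono) (auto simp: Basis_le_norm)
    also have "\<dots> \<le> c1 * norm M" by (simp add: c1_def algebra_simps sum_distrib_left)
    finally show ?thesis .
  qed
  have diff: "nrm M - nrm M' \<le> c1 * norm (M - M')" for M M'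
    using tri[of "M - M'" M'] upper[of "M - M'"] by simp
  have "continuous_on UNIV nrm"
  proof (rule continuous_onI)
    fix M e assume "0 < (e::real)"
    moreover have "\<bar>nrm M' - nrm M\<bar> \<le> c1 * norm (M' - M)" for M'
      using diff[of M M'] diff[of M' M] by (simp add: norm_minus_commute abs_le_iff)
    ultimately show "\<exists>d>0. \<forall>M'\<in>UNIV. dist M' M < d \<longrightarrow> dist (nrm M') (nrm M) \<le> e"
      using c1 by (intro exI[of _ "e / c1"])
        (auto simp: dist_norm field_simps intro: order_trans[OF _ less_imp_le])
  qed
  then have "continuous_on (sphere 0 1) nrm" by (rule continuous_on_subset) simp
  moreover have "sphere (0 :: complex^'d^'d) 1 \<noteq> {}" by simp
  ultimately obtain M0 where M0: "M0 \<in> sphere 0 1" "\<And>M. M \<in> sphere 0 1 \<Longrightarrow> nrm M0 \<le> nrm M"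
    using continuous_attains_inf[OF compact_sphere] by blast
  have n0: "0 < nrm M0" using M0(1) pos[of M0] zero[of M0] by (cases "M0 = 0") auto
  have "norm M \<le> (1 / nrm M0) * nrm M" for M
  proof (cases "M = 0")
    case True
    then show ?thesis using zero[of 0] by simp
  next
    case False
    then have "nrm M0 \<le> nrm ((1 / norm M) *\<^sub>R M)" by (intro M0(2)) simp
    then show ?thesis using False n0 by (simp add: scale field_simps)
  qed
  then show ?thesis using that[OF c1 _ upper, of "1 / nrm M0"] n0 by simp
qed

section \<open>Word sums: scaling and exponential bounds\<close>

lemma path_prod_scaled:
  "path_prod L (\<lambda>r. \<chi> j. exp (\<nu> * L $ j) *\<^sub>R (B r $ j)) s v = exp (\<nu> * wlen L v) *\<^sub>R path_prod L B s v"
proof (induction v arbitrary: s)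
  case (Cons j v)
  then show ?case
    by (simp add: bounded_bilinear.scaleR_left[OF bounded_bilinear_matrix_mult]
        bounded_bilinear.scaleR_right[OF bounded_bilinear_matrix_mult] distrib_left exp_add)
qed simp

text \<open>The factors multiply to the exponential of \<nu> times the length of the word, which is
  the same for all words of length \<open>x\<close>.\<close>

lemma word_sum_scaled:
  assumes "L \<in> pos_delays"
  shows "word_sum L (\<lambda>r. \<chi> j. exp (\<nu> * L $ j) *\<^sub>R (B r $ j)) x = exp (\<nu> * x) *\<^sub>R word_sum L B x"
  unfolding word_sum_eq[OF assms] path_prod_scaled scaleR_right.sum by (rule sum.cong) auto

lemma word_sum_cong:
  assumes "L \<in> pos_delays" "\<And>r. r \<in> \<L>_below L x \<Longrightarrow> B r = B' r"
  shows "word_sum L B x = word_sum L B' x"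
  unfolding word_sum_eq[OF assms(1)]
proof (rule sum.cong[OF refl])
  fix v assume "v \<in> {v. wlen L v = x}"
  then show "path_prod L B 0 v = path_prod L B' 0 v"
    using path_prod_cong[OF assms, where w = "[]" and v = v] by simp
qed

text \<open>Covers the small \<open>x\<close>, about which the limsup defining \<open>mu\<close>
  says nothing. Finitely many words occur, and each product is bounded geometrically in its number
  of letters.\<close>

lemma word_sum_bounded_up_to:
  fixes L :: "real^'N" and \<BB> :: "((complex^'d^'d)^'N) set"
  assumes L: "L \<in> pos_delays" and "bounded \<BB>"
  obtains C where "0 \<le> C" "\<And>B x. (\<And>r. B r \<in> \<BB>) \<Longrightarrow> x \<le> y \<Longrightarrow> norm (word_sum L B x) \<le> C"
proof -
  obtain R where R: "0 < R" "\<And>b. b \<in> \<BB> \<Longrightarrow> norm b \<le> R"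
    using assms(2) unfolding bounded_pos by blast
  obtain \<kappa> where \<kappa>: "0 < \<kappa>" "\<And>(M::complex^'d^'d) (M'::complex^'d^'d). norm (M ** M') \<le> norm M * norm M' * \<kappa>"
    using bounded_bilinear.pos_bounded[OF bounded_bilinear_matrix_mult] by blast
  define g where "g v = norm (mat 1 :: complex^'d^'d) * (R * \<kappa>) ^ length v" for v :: "'N list"
  have g: "0 \<le> g v" for v using R \<kappa> by (simp add: g_def)
  have path: "norm (path_prod L B s v) \<le> g v" if B: "\<And>r. B r \<in> \<BB>" for B s v
  proof (induction v arbitrary: s)
    case (Cons j v)
    have "norm (B s $ j) \<le> R"
      using R(2)[OF B] Finite_Cartesian_Product.norm_nth_le order_trans by blast
    then have "norm (B s $ j) * norm (path_prod L B (s + L $ j) v) * \<kappa> \<le> R * g v * \<kappa>"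
      using Cons.IH[of "s + L $ j"] R \<kappa> by (intro mult_right_mono mult_mono) auto
    then show ?case
      using \<kappa>(2)[of "B s $ j" "path_prod L B (s + L $ j) v"] by (simp add: g_def mult_ac)
  qed (simp add: g_def)
  show ?thesis
  proof (rule that)
    show "0 \<le> (\<Sum>v | wlen L v \<le> y. g v)" using g by (simp add: sum_nonneg)
    fix B :: "real \<Rightarrow> (complex^'d^'d)^'N" and x :: real assume B: "\<And>r. B r \<in> \<BB>" and x: "x \<le> y"
    have "norm (word_sum L B x) \<le> (\<Sum>v | wlen L v = x. g v)"
      unfolding word_sum_eq[OF L] using path[OF B] by (intro sum_norm_le) auto
    also have "\<dots> \<le> (\<Sum>v | wlen L v \<le> y. g v)"
      using x g finite_wlen_le[OF L] by (intro sum_mono2) auto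
    finally show "norm (word_sum L B x) \<le> (\<Sum>v | wlen L v \<le> y. g v)" .
  qed
qed

text \<open>A limsup below 1 leaves room for some \<rho> < 1 bounding the scaled word sums by a
  constant times \<rho>^x for large \<open>x\<close>; undoing the scaling gives the rate \<nu> + ln
  \<rho>, strictly below \<nu>.\<close>

lemma mu_less_one_imp_word_sum_bound:
  fixes \<Lambda> :: "real^'N" and \<BB> :: "((complex^'d^'d)^'N) set"
  assumes nrm: "is_matrix_norm nrm" and \<Lambda>: "\<Lambda> \<in> pos_delays" and bdd: "bounded \<BB>"
    and mu: "mu nrm \<Lambda> (scaled_set \<Lambda> (- \<nu>) \<BB>) < 1"
  obtains a C where "a < \<nu>" "0 \<le> C"
    "\<And>B x. (\<And>r. B r \<in> \<BB>) \<Longrightarrow> x \<in> \<L>_set \<Lambda> \<Longrightarrow> norm (word_sum \<Lambda> B x) \<le> C * exp (a * x)"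
proof -
  obtain c2 where c: "0 < c2" "\<And>M. norm M \<le> c2 * nrm M"
    using matrix_norm_equivalent[OF nrm] by metis
  obtain \<rho>0 where \<rho>0: "mu nrm \<Lambda> (scaled_set \<Lambda> (- \<nu>) \<BB>) < ereal \<rho>0" "ereal \<rho>0 < 1"
    using ereal_dense2[OF mu] by blast
  \<comment> \<open>The maximum keeps \<rho> positive, so that its logarithm may be used.\<close>
  define \<rho> where "\<rho> = max \<rho>0 (1 / 2)"
  have \<rho>: "0 < \<rho>" "\<rho> < 1" "\<rho>0 \<le> \<rho>" using \<rho>0(2) by (auto simp: \<rho>_def)
  have "eventually (\<lambda>x. (SUP B\<in>Pi (\<L>_below \<Lambda> x) (\<lambda>_. scaled_set \<Lambda> (- \<nu>) \<BB>).
      ereal (nrm (word_sum \<Lambda> B x) powr (1 / x))) < ereal \<rho>0) (inf at_top (principal (\<L>_set \<Lambda>)))"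
    using \<rho>0(1) unfolding mu_def by (rule Limsup_lessD)
  then obtain x0 where x0: "\<And>x. x0 \<le> x \<Longrightarrow> x \<in> \<L>_set \<Lambda> \<Longrightarrow>
      (SUP B\<in>Pi (\<L>_below \<Lambda> x) (\<lambda>_. scaled_set \<Lambda> (- \<nu>) \<BB>). ereal (nrm (word_sum \<Lambda> B x) powr (1 / x))) < ereal \<rho>0"
    by (auto simp: eventually_inf_principal eventually_at_top_linorder)
  define x1 where "x1 = max x0 1"
  obtain C1 where C1: "0 \<le> C1" "\<And>B x. (\<And>r. B r \<in> \<BB>) \<Longrightarrow> x \<le> x1 \<Longrightarrow> norm (word_sum \<Lambda> B x) \<le> C1"
    using word_sum_bounded_up_to[OF \<Lambda> bdd] by blast
  define a where "a = \<nu> + ln \<rho>"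
  \<comment> \<open>The second summand covers \<open>x < x1\<close>, where
    \<open>exp (\<bar>a\<bar> * x1) * exp (a * x)\<close> is at least 1.\<close>
  define C where "C = c2 + C1 * exp (\<bar>a\<bar> * x1)"
  have C: "c2 \<le> C" "C1 * exp (\<bar>a\<bar> * x1) \<le> C" using c C1(1) by (auto simp: C_def)
  show ?thesis
  proof (rule that)
    show "a < \<nu>" using \<rho> by (simp add: a_def)
    show "0 \<le> C" using C c by simp
    fix B :: "real \<Rightarrow> (complex^'d^'d)^'N" and x :: real assume B: "\<And>r. B r \<in> \<BB>" and x: "x \<in> \<L>_set \<Lambda>"
    show "norm (word_sum \<Lambda> B x) \<le> C * exp (a * x)"
    proof (cases "x1 \<le> x")
      case True
      then have x': "x0 \<le> x" "0 < x" by (auto simp: x1_def)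
      define B' where "B' r = (\<chi> j. exp (- \<nu> * \<Lambda> $ j) *\<^sub>R (B r $ j))" for r
      have eq: "word_sum \<Lambda> B' x = exp (- \<nu> * x) *\<^sub>R word_sum \<Lambda> B x"
        unfolding B'_def by (rule word_sum_scaled[OF \<Lambda>])
      have "B' \<in> Pi (\<L>_below \<Lambda> x) (\<lambda>_. scaled_set \<Lambda> (- \<nu>) \<BB>)"
        using B by (auto simp: B'_def scaled_set_def)
      then have "ereal (nrm (word_sum \<Lambda> B' x) powr (1 / x)) < ereal \<rho>0"
        using le_less_trans[OF SUP_upper x0[OF x'(1) x]] by blast
      then have "nrm (word_sum \<Lambda> B' x) powr (1 / x) \<le> \<rho>" using \<rho> by simp
      then have "(nrm (word_sum \<Lambda> B' x) powr (1 / x)) powr x \<le> \<rho> powr x"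
        using x' by (intro powr_mono2) auto
      moreover have "0 \<le> nrm (word_sum \<Lambda> B' x)" using nrm by (simp add: is_matrix_norm_def)
      ultimately have "nrm (word_sum \<Lambda> B' x) \<le> \<rho> powr x"
        using x' by (simp add: powr_powr)
      also have "\<dots> = exp (ln \<rho> * x)" using \<rho> by (simp add: powr_def mult.commute)
      finally have "nrm (word_sum \<Lambda> B' x) \<le> exp (ln \<rho> * x)" .
      then have "norm (word_sum \<Lambda> B' x) \<le> c2 * exp (ln \<rho> * x)"
        using c by (meson mult_left_mono order_trans less_imp_le)
      then have "exp (\<nu> * x) * norm (word_sum \<Lambda> B' x) \<le> exp (\<nu> * x) * (c2 * exp (ln \<rho> * x))"
        by (intro mult_left_mono) auto
      moreover have "exp (\<nu> * x) * norm (word_sum \<Lambda> B' x) = norm (word_sum \<Lambda> B x)"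
        by (simp add: eq exp_minus field_simps)
      ultimately have "norm (word_sum \<Lambda> B x) \<le> c2 * exp (a * x)"
        by (simp add: a_def exp_add algebra_simps)
      also have "\<dots> \<le> C * exp (a * x)" using C by simp
      finally show ?thesis .
    next
      case False
      have "0 \<le> x" using x wlen_nonneg[OF \<Lambda>] by (auto simp: \<L>_set_eq)
      then have "exp (a * 0) \<le> exp (\<bar>a\<bar> * x1) * exp (a * x)"
        using False by (intro exp_mult_le_exp_shift) auto
      then have "C1 * 1 \<le> C1 * (exp (\<bar>a\<bar> * x1) * exp (a * x))"
        using C1(1) by (intro mult_left_mono) auto
      also have "\<dots> \<le> C * exp (a * x)" using mult_right_mono[OF C(2), of "exp (a * x)"] by (simp add: mult_ac)
      finally show ?thesis using C1(2)[of B x, OF B] False by simp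
    qed
  qed
qed

text \<open>Scaling turns the bound into decay at rate \<open>\<nu> - a\<close>, and the root
  \<open>1 / x\<close> makes constant factors irrelevant in the limit.\<close>

lemma word_sum_bound_imp_mu_less_one:
  fixes \<Lambda> :: "real^'N" and \<BB> :: "((complex^'d^'d)^'N) set"
  assumes nrm: "is_matrix_norm nrm" and \<Lambda>: "\<Lambda> \<in> pos_delays" and "a < \<nu>"
    and bound: "\<And>B x. x0 \<le> x \<Longrightarrow> x \<in> \<L>_set \<Lambda> \<Longrightarrow> B \<in> Pi (\<L>_below \<Lambda> x) (\<lambda>_. \<BB>) \<Longrightarrow>
      norm (word_sum \<Lambda> B x) \<le> C * exp (a * x)"
  shows "mu nrm \<Lambda> (scaled_set \<Lambda> (- \<nu>) \<BB>) < 1"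
proof -
  obtain c1 where c1: "0 < c1" "\<And>M. nrm M \<le> c1 * norm M"
    using matrix_norm_equivalent[OF nrm] by metis
  \<comment> \<open>A positive majorant of \<open>c1 * C\<close>, so that \<open>ln c\<close> can be
    formed whatever the sign of \<open>C\<close>.\<close>
  define c where "c = c1 * \<bar>C\<bar> + 1"
  have c: "0 < c" "c1 * C \<le> c"
  proof -
    have "0 \<le> c1 * \<bar>C\<bar>" "c1 * C \<le> c1 * \<bar>C\<bar>" using c1 by (auto intro: mult_left_mono)
    then show "0 < c" "c1 * C \<le> c" by (auto simp: c_def)
  qed
  \<comment> \<open>Half of the gap absorbs \<open>c\<close> once
    \<open>x \<ge> ln c / \<delta>\<close>; the other half leaves the bound
    \<open>exp (- \<delta>)\<close>, uniform in \<open>x\<close>.\<close>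
  define \<delta> where "\<delta> = (\<nu> - a) / 2"
  have \<delta>: "0 < \<delta>" using \<open>a < \<nu>\<close> by (simp add: \<delta>_def)
  have "(SUP B\<in>Pi (\<L>_below \<Lambda> x) (\<lambda>_. scaled_set \<Lambda> (- \<nu>) \<BB>). ereal (nrm (word_sum \<Lambda> B x) powr (1 / x)))
      \<le> ereal (exp (- \<delta>))" if x: "max x0 (max 1 (ln c / \<delta>)) \<le> x" "x \<in> \<L>_set \<Lambda>" for x
  proof (rule SUP_least)
    fix B' assume "B' \<in> Pi (\<L>_below \<Lambda> x) (\<lambda>_. scaled_set \<Lambda> (- \<nu>) \<BB>)"
    then have "\<forall>r\<in>\<L>_below \<Lambda> x. \<exists>b\<in>\<BB>. B' r = (\<chi> j. exp (- \<nu> * \<Lambda> $ j) *\<^sub>R (b $ j))"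
      by (auto simp: scaled_set_def)
    \<comment> \<open>A preimage under the scaling is chosen at each \<open>r\<close> below
      \<open>x\<close>; \<open>word_sum_cong\<close> ignores all other \<open>r\<close>.\<close>
    then obtain B where B: "\<And>r. r \<in> \<L>_below \<Lambda> x \<Longrightarrow> B r \<in> \<BB> \<and> B' r = (\<chi> j. exp (- \<nu> * \<Lambda> $ j) *\<^sub>R (B r $ j))"
      by metis
    have x0: "x0 \<le> x" "0 < x" "ln c \<le> \<delta> * x" using x(1) \<delta> by (auto simp: field_simps)
    have "word_sum \<Lambda> B' x = word_sum \<Lambda> (\<lambda>r. \<chi> j. exp (- \<nu> * \<Lambda> $ j) *\<^sub>R (B r $ j)) x"
      using B by (intro word_sum_cong[OF \<Lambda>]) auto
    also have "\<dots> = exp (- \<nu> * x) *\<^sub>R word_sum \<Lambda> B x"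
      by (rule word_sum_scaled[OF \<Lambda>])
    finally have "norm (word_sum \<Lambda> B' x) = exp (- \<nu> * x) * norm (word_sum \<Lambda> B x)" by simp
    also have "\<dots> \<le> exp (- \<nu> * x) * (C * exp (a * x))"
      using B x0 x(2) by (intro mult_left_mono bound) auto
    finally have "nrm (word_sum \<Lambda> B' x) \<le> c1 * (exp (- \<nu> * x) * (C * exp (a * x)))"
      using c1 by (meson mult_left_mono order_trans less_imp_le)
    also have "\<dots> = c1 * C * exp (- 2 * \<delta> * x)"
      by (simp add: \<delta>_def algebra_simps flip: exp_add)
    also have "\<dots> \<le> c * exp (- 2 * \<delta> * x)" using c by (intro mult_right_mono) auto
    also have "\<dots> = exp (ln c + - 2 * \<delta> * x)" using c by (simp add: exp_diff exp_minus field_simps)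
    also have "\<dots> \<le> exp (- \<delta> * x)" using x0 by simp
    finally have "nrm (word_sum \<Lambda> B' x) powr (1 / x) \<le> exp (- \<delta> * x) powr (1 / x)"
      using x0 nrm by (intro powr_mono2) (auto simp: is_matrix_norm_def)
    also have "\<dots> = exp (- \<delta>)" using x0 by (simp add: powr_def)
    finally show "ereal (nrm (word_sum \<Lambda> B' x) powr (1 / x)) \<le> ereal (exp (- \<delta>))" by simp
  qed
  then have "mu nrm \<Lambda> (scaled_set \<Lambda> (- \<nu>) \<BB>) \<le> ereal (exp (- \<delta>))"
    unfolding mu_def
    by (intro Limsup_bounded, unfold eventually_inf_principal)
       (rule eventually_mono[OF eventually_ge_at_top[of "max x0 (max 1 (ln c / \<delta>))"]], blast)
  also have "\<dots> < 1" using \<delta> by simp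
  finally show ?thesis .
qed

section \<open>Equivalence of \<mu> < 1 with exponential stability\<close>

lemma scaled_set_zero [simp]: "scaled_set \<Lambda> 0 \<BB> = \<BB>"
  by (simp add: scaled_set_def)

text \<open>Converts decay in the \<open>\<Lambda>\<close>-length into decay in the
  \<open>L\<close>-length; \<open>c\<close> is the smallest ratio of corresponding delays.\<close>

lemma wlen_comparable:
  assumes "\<Lambda> \<in> pos_delays" "L \<in> pos_delays"
  obtains c where "0 < c" "\<And>v. c * wlen L v \<le> wlen \<Lambda> v"
proof -
  define c where "c = Min (range (\<lambda>j. \<Lambda> $ j / L $ j))"
  have c: "0 < c" using assms by (auto simp: c_def pos_delays_def)
  have "c * L $ j \<le> \<Lambda> $ j" for j
  proof -
    have "c \<le> \<Lambda> $ j / L $ j" unfolding c_def by (rule Min_le) auto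
    then show ?thesis using assms by (simp add: pos_delays_def field_simps)
  qed
  then have "c * wlen L v \<le> wlen \<Lambda> v" for v
  proof (induction v)
    case (Cons j v)
    then show ?case using Cons.prems[of j] by (simp add: distrib_left add_mono)
  qed simp
  with c that show ?thesis by blast
qed

lemma V_plus_refl: "\<Lambda> \<in> pos_delays \<Longrightarrow> \<Lambda> \<in> V_plus \<Lambda>"
  by (simp add: V_plus_def)

lemma mu_less_one_imp_exponentially_stable:
  fixes \<Lambda> :: "real^'N" and \<BB> :: "((complex^'d^'d)^'N) set"
  assumes nrm: "is_matrix_norm nrm" and \<Lambda>: "\<Lambda> \<in> pos_delays" and bdd: "bounded \<BB>"
    and mu: "mu nrm \<Lambda> \<BB> < 1" and L: "L \<in> V_plus \<Lambda>" and p: "1 \<le> p"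
  shows "exponentially_stable L (L_infty \<BB>) p"
proof -
  obtain a C where aC: "a < 0" "0 \<le> C"
    "\<And>B x. (\<And>r. B r \<in> \<BB>) \<Longrightarrow> x \<in> \<L>_set \<Lambda> \<Longrightarrow> norm (word_sum \<Lambda> B x) \<le> C * exp (a * x)"
    using mu_less_one_imp_word_sum_bound[OF nrm \<Lambda> bdd, of 0] mu by auto
  obtain c where c: "0 < c" "\<And>v. c * wlen L v \<le> wlen \<Lambda> v"
    using wlen_comparable[OF \<Lambda>] L by (auto simp: V_plus_def)
  have bound: "norm (word_sum \<Lambda> B (wlen \<Lambda> v)) \<le> C * exp ((a * c) * wlen L v)"
    if B: "\<And>r. B r \<in> \<BB>" for v B
  proof -
    \<comment> \<open>Here \<open>a < 0\<close> reverses the inequality between the two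
      lengths.\<close>
    have "a * wlen \<Lambda> v \<le> a * (c * wlen L v)" using aC(1) c(2)[of v] by (intro mult_left_mono_neg) auto
    then have "C * exp (a * wlen \<Lambda> v) \<le> C * exp ((a * c) * wlen L v)"
      using aC(2) by (intro mult_left_mono) (auto simp: mult_ac)
    then show ?thesis using aC(3)[of B "wlen \<Lambda> v", OF B] by (simp add: \<L>_set_eq)
  qed
  \<comment> \<open>Strictly above \<open>a * c\<close>, to absorb the polynomial factors, and still
    negative.\<close>
  define b where "b = a * c / 2"
  have "a * c < 0" using aC(1) c(1) by (simp add: mult_neg_pos)
  then have b: "a * c < b" "b < 0" by (simp_all add: b_def)
  obtain K where K: "0 < K"
    "\<And>A u0 u t. A \<in> L_infty \<BB> \<Longrightarrow> u0 \<in> X_space L p \<Longrightarrow> is_solution L A u0 u \<Longrightarrow> 0 \<le> t \<Longrightarrow>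
      state_norm L p (shifted u t) \<le> ennreal (K * exp (b * t)) * state_norm L p u0"
    using state_norm_growth_bound[OF \<Lambda> L bdd aC(2) bound b(1) p] by blast
  have "exponential_type L (L_infty \<BB>) p b"
    unfolding exponential_type_def
  proof (intro allI impI)
    \<comment> \<open>The estimate already holds at rate \<open>b\<close>, and a positive \<epsilon>
      only weakens it.\<close>
    fix \<epsilon> :: real assume "0 < \<epsilon>"
    then have "ennreal (K * exp (b * t)) * z \<le> ennreal (K * exp ((b + \<epsilon>) * t)) * z" if "0 \<le> t" for t z
      using that K(1) by (intro mult_right_mono ennreal_leI mult_left_mono) (auto intro!: mult_right_mono)
    then show "\<exists>K>0. \<forall>A\<in>L_infty \<BB>. \<forall>u0\<in>X_space L p. \<forall>u. is_solution L A u0 u \<longrightarrow>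
        (\<forall>t\<ge>0. state_norm L p (shifted u t) \<le> ennreal (K * exp ((b + \<epsilon>) * t)) * state_norm L p u0)"
      using K by (intro exI[of _ K]) (blast intro: order_trans)
  qed
  with b(2) show ?thesis unfolding exponentially_stable_def by blast
qed

lemma exponentially_stable_imp_mu_less_one:
  fixes \<Lambda> :: "real^'N" and \<BB> :: "((complex^'d^'d)^'N) set"
  assumes nrm: "is_matrix_norm nrm" and \<Lambda>: "\<Lambda> \<in> pos_delays" and ne: "\<BB> \<noteq> {}"
    and p: "1 \<le> p" and st: "exponentially_stable \<Lambda> (L_infty \<BB>) p"
  shows "mu nrm \<Lambda> \<BB> < 1"
proof -
  obtain \<gamma> where \<gamma>: "\<gamma> < 0" "exponential_type \<Lambda> (L_infty \<BB>) p \<gamma>"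
    using st by (auto simp: exponentially_stable_def)
  \<comment> \<open>The definition of exponential type is used with
    \<open>\<epsilon> = - \<gamma> / 2\<close>, which leaves the negative rate
    \<open>\<gamma> / 2\<close>.\<close>
  define b where "b = \<gamma> + (- \<gamma> / 2)"
  have b: "b < 0" using \<gamma> by (simp add: b_def)
  have "0 < - \<gamma> / 2" using \<gamma> by simp
  from \<gamma>(2)[unfolded exponential_type_def, rule_format, OF this]
  obtain K where K: "0 < K" "\<And>A u0 u t. A \<in> L_infty \<BB> \<Longrightarrow> u0 \<in> X_space \<Lambda> p \<Longrightarrow> is_solution \<Lambda> A u0 u \<Longrightarrow> 0 \<le> t \<Longrightarrow>
      state_norm \<Lambda> p (shifted u t) \<le> ennreal (K * exp (b * t)) * state_norm \<Lambda> p u0"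
    unfolding b_def by blast
  have "mu nrm \<Lambda> (scaled_set \<Lambda> (- 0) \<BB>) < 1"
  proof (rule word_sum_bound_imp_mu_less_one[OF nrm \<Lambda> b])
    fix B :: "real \<Rightarrow> (complex^'d^'d)^'N" and x
    assume x: "1 \<le> x" "x \<in> \<L>_set \<Lambda>" and B: "B \<in> Pi (\<L>_below \<Lambda> x) (\<lambda>_. \<BB>)"
    have "norm (word_sum \<Lambda> B x) \<le> real CARD('d) * real CARD('d) * (K * exp (b * x))"
    proof (rule word_sum_le_of_solution_bound[OF \<Lambda> p x(2) _ B ne])
      show "state_norm \<Lambda> p (shifted u x) \<le> ennreal (K * exp (b * x))"
        if "A \<in> L_infty \<BB>" "u0 \<in> X_space \<Lambda> p" "state_norm \<Lambda> p u0 = 1" "is_solution \<Lambda> A u0 u" for A u0 u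
        using K(2)[OF that(1,2,4), of x] x that(3) by simp
    qed (use x K in auto)
    then show "norm (word_sum \<Lambda> B x) \<le> real CARD('d) * real CARD('d) * K * exp (b * x)"
      by (simp add: mult_ac)
  qed
  then show ?thesis by simp
qed

section \<open>The Lyapunov exponent as an infimum\<close>

lemma ext_ln_le_ln: "x \<le> ennreal y \<Longrightarrow> 0 < y \<Longrightarrow> ext_ln x \<le> ereal (ln y)"
  by (cases x) (auto simp: ext_ln_def top_unique ennreal_eq_0_iff)

lemma le_exp_of_ext_ln_less:
  assumes "ext_ln x < ereal y"
  shows "x \<le> ennreal (exp y)"
proof (cases x)
  case (real r)
  show ?thesis
  proof (cases "r = 0")
    case False
    then have "ln r \<le> y" using assms real by (simp add: ext_ln_def)
    then have "exp (ln r) \<le> exp y" by (simp only: exp_le_cancel_iff)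
    then show ?thesis using False real by (simp add: ennreal_leI)
  qed (simp add: real)
qed (use assms in \<open>simp add: ext_ln_def\<close>)

text \<open>The word sums grow at some rate \<open>a < \<nu>\<close>, so the solutions are bounded
  by \<open>K * exp (\<nu> * t)\<close>; on the logarithmic scale \<open>K\<close> contributes
  \<open>ln K / t\<close>, which tends to 0.\<close>

lemma lyapunov_exponent_le:
  fixes \<Lambda> :: "real^'N" and \<BB> :: "((complex^'d^'d)^'N) set"
  assumes nrm: "is_matrix_norm nrm" and \<Lambda>: "\<Lambda> \<in> pos_delays" and bdd: "bounded \<BB>" and p: "1 \<le> p"
    and mu: "mu nrm \<Lambda> (scaled_set \<Lambda> (- \<nu>) \<BB>) < 1"
  shows "lyapunov_exponent \<Lambda> (L_infty \<BB>) p \<le> ereal \<nu>"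
proof -
  obtain a C where aC: "a < \<nu>" "0 \<le> C"
    "\<And>B x. (\<And>r. B r \<in> \<BB>) \<Longrightarrow> x \<in> \<L>_set \<Lambda> \<Longrightarrow> norm (word_sum \<Lambda> B x) \<le> C * exp (a * x)"
    using mu_less_one_imp_word_sum_bound[OF nrm \<Lambda> bdd mu] by blast
  have "norm (word_sum \<Lambda> B (wlen \<Lambda> v)) \<le> C * exp (a * wlen \<Lambda> v)" if "\<And>r. B r \<in> \<BB>" for v B
    using aC(3)[OF that] by (simp add: \<L>_set_eq)
  then obtain K where K: "0 < K"
    "\<And>A u0 u t. A \<in> L_infty \<BB> \<Longrightarrow> u0 \<in> X_space \<Lambda> p \<Longrightarrow> is_solution \<Lambda> A u0 u \<Longrightarrow> 0 \<le> t \<Longrightarrow>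
      state_norm \<Lambda> p (shifted u t) \<le> ennreal (K * exp (\<nu> * t)) * state_norm \<Lambda> p u0"
    using state_norm_growth_bound[OF \<Lambda> V_plus_refl[OF \<Lambda>] bdd aC(2) _ aC(1) p] by blast
  have "(SUP A\<in>L_infty \<BB>. SUP u0\<in>{u0 \<in> X_space \<Lambda> p. state_norm \<Lambda> p u0 = 1}. SUP u\<in>{u. is_solution \<Lambda> A u0 u}.
         ext_ln (state_norm \<Lambda> p (shifted u t)) / ereal t) \<le> ereal (ln K / t + \<nu>)" if t: "0 < t" for t
  proof (intro SUP_least)
    fix A :: "real \<Rightarrow> (complex^'d^'d)^'N" and u0 u
    assume A: "A \<in> L_infty \<BB>" and u0: "u0 \<in> {u0 \<in> X_space \<Lambda> p. state_norm \<Lambda> p u0 = 1}"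
      and u: "u \<in> {u. is_solution \<Lambda> A u0 u}"
    have "state_norm \<Lambda> p (shifted u t) \<le> ennreal (K * exp (\<nu> * t))"
      using K(2)[OF A _ _ less_imp_le[OF t], of u0 u] u0 u by simp
    then have "ext_ln (state_norm \<Lambda> p (shifted u t)) \<le> ereal (ln (K * exp (\<nu> * t)))"
      using K(1) by (intro ext_ln_le_ln) auto
    then have "ext_ln (state_norm \<Lambda> p (shifted u t)) / ereal t \<le> ereal (ln (K * exp (\<nu> * t))) / ereal t"
      using t by (intro ereal_divide_right_mono) auto
    also have "\<dots> = ereal (ln K / t + \<nu>)" using K(1) t by (simp add: ln_mult add_divide_distrib)
    finally show "ext_ln (state_norm \<Lambda> p (shifted u t)) / ereal t \<le> \<dots>" .
  qed
  then have "lyapunov_exponent \<Lambda> (L_infty \<BB>) p \<le> Limsup at_top (\<lambda>t. ereal (ln K / t + \<nu>))"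
    unfolding lyapunov_exponent_def
    by (intro Limsup_mono) (auto intro: eventually_mono[OF eventually_gt_at_top[of 0]])
  also have "\<dots> = ereal \<nu>"
  proof (rule lim_imp_Limsup)
    have "((\<lambda>t. ln K / t + \<nu>) \<longlongrightarrow> 0 + \<nu>) at_top"
      by (intro tendsto_intros tendsto_divide_0[OF tendsto_const] filterlim_at_top_imp_at_infinity filterlim_ident)
    then show "((\<lambda>t. ereal (ln K / t + \<nu>)) \<longlongrightarrow> ereal \<nu>) at_top" by simp
  qed simp
  finally show ?thesis .
qed

lemma mu_less_one_of_lyapunov_exponent_less:
  fixes \<Lambda> :: "real^'N" and \<BB> :: "((complex^'d^'d)^'N) set"
  assumes nrm: "is_matrix_norm nrm" and \<Lambda>: "\<Lambda> \<in> pos_delays" and ne: "\<BB> \<noteq> {}" and p: "1 \<le> p"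
    and less: "lyapunov_exponent \<Lambda> (L_infty \<BB>) p < ereal \<nu>"
  shows "mu nrm \<Lambda> (scaled_set \<Lambda> (- \<nu>) \<BB>) < 1"
proof -
  \<comment> \<open>An intermediate \<open>b\<close> provides the strict gap below \<nu> that
    \<open>word_sum_bound_imp_mu_less_one\<close> requires.\<close>
  obtain b where b: "lyapunov_exponent \<Lambda> (L_infty \<BB>) p < ereal b" "b < \<nu>"
    using ereal_dense2[OF less] by auto
  obtain T where T: "\<And>t. T \<le> t \<Longrightarrow> (SUP A\<in>L_infty \<BB>. SUP u0\<in>{u0 \<in> X_space \<Lambda> p. state_norm \<Lambda> p u0 = 1}.
       SUP u\<in>{u. is_solution \<Lambda> A u0 u}. ext_ln (state_norm \<Lambda> p (shifted u t)) / ereal t) < ereal b"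
    using Limsup_lessD[OF b(1)[unfolded lyapunov_exponent_def]]
    by (auto simp: eventually_at_top_linorder)
  show ?thesis
  proof (rule word_sum_bound_imp_mu_less_one[OF nrm \<Lambda> b(2)])
    fix B :: "real \<Rightarrow> (complex^'d^'d)^'N" and x
    assume x: "max T 1 \<le> x" "x \<in> \<L>_set \<Lambda>" and B: "B \<in> Pi (\<L>_below \<Lambda> x) (\<lambda>_. \<BB>)"
    have x0: "T \<le> x" "0 < x" using x by auto
    show "norm (word_sum \<Lambda> B x) \<le> real CARD('d) * real CARD('d) * exp (b * x)"
    proof (rule word_sum_le_of_solution_bound[OF \<Lambda> p x(2) _ B ne])
      fix A :: "real \<Rightarrow> (complex^'d^'d)^'N" and u0 u
      assume A: "A \<in> L_infty \<BB>" "u0 \<in> X_space \<Lambda> p" "state_norm \<Lambda> p u0 = 1" "is_solution \<Lambda> A u0 u"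
      have "ext_ln (state_norm \<Lambda> p (shifted u x)) / ereal x \<le>
          (SUP A\<in>L_infty \<BB>. SUP u0\<in>{u0 \<in> X_space \<Lambda> p. state_norm \<Lambda> p u0 = 1}.
            SUP u\<in>{u. is_solution \<Lambda> A u0 u}. ext_ln (state_norm \<Lambda> p (shifted u x)) / ereal x)"
        using A by (intro SUP_upper2[of A] SUP_upper2[of u0] SUP_upper2[of u]) auto
      also have "\<dots> < ereal b" by (rule T[OF x0(1)])
      finally have "ext_ln (state_norm \<Lambda> p (shifted u x)) < ereal (b * x)"
        using x0(2) by (simp add: ereal_divide_less_iff mult.commute)
      then show "state_norm \<Lambda> p (shifted u x) \<le> ennreal (exp (b * x))"
        by (rule le_exp_of_ext_ln_less)
    qed (use x0 in auto)
  qed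
qed

theorem corollary3p29:
  fixes \<Lambda> :: "real^'N"
    and \<BB> :: "((complex^'d^'d)^'N) set"
    and nrm :: "complex^'d^'d \<Rightarrow> real"
  assumes "is_matrix_norm nrm"
    and "\<Lambda> \<in> pos_delays"
    and "\<BB> \<noteq> {}"
    and "bounded \<BB>"
  shows "(mu nrm \<Lambda> \<BB> < 1 \<longleftrightarrow>
            (\<exists>p\<ge>1. exponentially_stable \<Lambda> (L_infty \<BB>) p)) \<and>
         (mu nrm \<Lambda> \<BB> < 1 \<longleftrightarrow>
            (\<forall>L\<in>V_plus \<Lambda>. \<forall>p\<ge>1. exponentially_stable L (L_infty \<BB>) p)) \<and>
         (\<forall>p\<ge>1. lyapunov_exponent \<Lambda> (L_infty \<BB>) p =
            Inf (ereal ` {\<nu>. mu nrm \<Lambda> (scaled_set \<Lambda> (- \<nu>) \<BB>) < 1}))"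
proof (intro conjI allI impI)
  note stable = mu_less_one_imp_exponentially_stable[OF assms(1,2,4)]
  note unstable = exponentially_stable_imp_mu_less_one[OF assms(1,2,3)]
  note refl = V_plus_refl[OF assms(2)]
  show "mu nrm \<Lambda> \<BB> < 1 \<longleftrightarrow> (\<exists>p\<ge>1. exponentially_stable \<Lambda> (L_infty \<BB>) p)"
    using stable[OF _ refl, of 1] unstable by blast
  show "mu nrm \<Lambda> \<BB> < 1 \<longleftrightarrow> (\<forall>L\<in>V_plus \<Lambda>. \<forall>p\<ge>1. exponentially_stable L (L_infty \<BB>) p)"
    \<comment> \<open>The converse specialises to \<open>L = \<Lambda>\<close> and
      \<open>p = 1\<close>.\<close>
    using stable unstable[of 1] refl by blast
  fix p :: ennreal assume p: "1 \<le> p"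
  show "lyapunov_exponent \<Lambda> (L_infty \<BB>) p = Inf (ereal ` {\<nu>. mu nrm \<Lambda> (scaled_set \<Lambda> (- \<nu>) \<BB>) < 1})"
  proof (rule antisym)
    show "lyapunov_exponent \<Lambda> (L_infty \<BB>) p \<le> Inf (ereal ` {\<nu>. mu nrm \<Lambda> (scaled_set \<Lambda> (- \<nu>) \<BB>) < 1})"
      using lyapunov_exponent_le[OF assms(1,2,4) p] by (auto intro!: Inf_greatest)
    show "Inf (ereal ` {\<nu>. mu nrm \<Lambda> (scaled_set \<Lambda> (- \<nu>) \<BB>) < 1}) \<le> lyapunov_exponent \<Lambda> (L_infty \<BB>) p"
    proof (rule ccontr)
      assume "\<not> ?thesis"
      \<comment> \<open>A real \<nu> strictly between the exponent and the infimum would itself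
        belong to the set, contradicting that it lies below the infimum.\<close>
      then obtain \<nu> where \<nu>: "lyapunov_exponent \<Lambda> (L_infty \<BB>) p < ereal \<nu>"
        "ereal \<nu> < Inf (ereal ` {\<nu>. mu nrm \<Lambda> (scaled_set \<Lambda> (- \<nu>) \<BB>) < 1})"
        using ereal_dense2 by (auto simp: not_le)
      have "mu nrm \<Lambda> (scaled_set \<Lambda> (- \<nu>) \<BB>) < 1"
        by (rule mu_less_one_of_lyapunov_exponent_less[OF assms(1,2,3) p \<nu>(1)])
      then have "Inf (ereal ` {\<nu>. mu nrm \<Lambda> (scaled_set \<Lambda> (- \<nu>) \<BB>) < 1}) \<le> ereal \<nu>"
        by (intro Inf_lower) auto
      with \<nu>(2) show False by simp
    qed
  qed
qed

end
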